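(* The functor $E\mapsto E^r$, $\pi\mapsto\pi^r$, from the category of $C^*$-trings into the category of $C^*$-algebras, is exact. More precisely: if $$0\to F_1\xrightarrow{\ \phi\ }F_2\xrightarrow{\ \psi\ }F_3\to 0$$ is an exact sequence of $C^*$-trings, then the sequence of $C^*$-algebras $$0\to F_1^r\xrightarrow{\ \phi^r\ }F_2^r\xrightarrow{\ \psi^r\ }F_3^r\to 0$$ is also exact.
   Context: A $*$-ternary ring ($*$-tring) is a complex vector space $E$ with a map $(\cdot,\cdot,\cdot):E\times E\times E\to E$, linear in the first and third variables and conjugate linear in the second, such that $((x,y,z),u,v)=(x,(u,z,y),v)=(x,y,(z,u,v))$ for all $x,y,z,u,v\in E$. A $C^*$-tring is a $*$-tring $E$ which is a Banach space under a norm with $\|(x,y,z)\|\le\|x\|\|y\|\|z\|$ and $\|(x,x,x)\|=\|x\|^3$. Morphisms of $C^*$-trings are homomorphisms of $*$-trings, i.e. linear maps preserving the ternary products. For a $C^*$-tring $E$, $E_0^r$ is the linear span of the maps $\langle y,z\rangle_r:E\to E$, $x\mapsto(x,y,z)$ ($y,z\in E$), a $*$-algebra with product opposite to composition and involution determined by $\langle y,z\rangle_r^*=\langle z,y\rangle_r$, acting on $E$ on the right by evaluation. $E^r$ is the $C^*$-algebra obtained by completing $E_0^r$ in the operator norm $a\mapsto\sup\{\|xa\|:\|x\|\le1\}$. For a homomorphism $\pi:E\to F$ of $C^*$-trings, $\pi^r:E^r\to F^r$ is the unique $*$-homomorphism with $\pi^r(\langle x,y\rangle_r)=\langle\pi(x),\pi(y)\rangle_r$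 for all $x,y\in E$. A sequence $0\to F_1\xrightarrow{\phi}F_2\xrightarrow{\psi}F_3\to0$ of $C^*$-trings is exact if $\phi,\psi$ are homomorphisms, $\phi$ is injective, $\psi$ is surjective and $\ker\psi=\phi(F_1)$. *)

theory Defs
  imports "HOL-Analysis.Analysis"
begin

section \<open>Complex vector spaces\<close>

text \<open>
  The distribution only has real vector spaces as type classes; the complex scalar multiplication is
  required to extend the real one, so that the topological notions available for real
  normed spaces can be used unchanged.
\<close>

class complex_vector = real_vector +
  fixes scaleC :: "complex \<Rightarrow> 'a \<Rightarrow> 'a" (infixr \<open>*\<^sub>C\<close> 75)
  assumes scaleC_add_right: "c *\<^sub>C (x + y) = c *\<^sub>C x + c *\<^sub>C y"
    and scaleC_add_left: "(c + d) *\<^sub>C x = c *\<^sub>C x + d *\<^sub>C x"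
    and scaleC_scaleC: "c *\<^sub>C (d *\<^sub>C x) = (c * d) *\<^sub>C x"
    and scaleC_one: "1 *\<^sub>C x = x"
    and scaleR_scaleC: "r *\<^sub>R x = complex_of_real r *\<^sub>C x"

class complex_normed_vector = complex_vector + real_normed_vector +
  assumes norm_scaleC: "norm (c *\<^sub>C x) = cmod c * norm x"

global_interpretation complex_vector:
  vector_space "scaleC :: complex \<Rightarrow> 'a \<Rightarrow> 'a::complex_vector"
  defines cspan_raw_def: cspan = complex_vector.span
    and csubspace_raw_def: csubspace = complex_vector.subspace
  by unfold_locales (simp_all add: scaleC_add_right scaleC_add_left scaleC_scaleC scaleC_one)

abbreviation clinear :: "('a::complex_vector \<Rightarrow> 'b::complex_vector) \<Rightarrow> bool"
  where "clinear \<equiv> Vector_Spaces.linear scaleC scaleC"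

instantiation blinfun :: (real_normed_vector, complex_normed_vector) complex_normed_vector
begin

lift_definition scaleC_blinfun :: "complex \<Rightarrow> ('a \<Rightarrow>\<^sub>L 'b) \<Rightarrow> 'a \<Rightarrow>\<^sub>L 'b"
  is "\<lambda>c f x. c *\<^sub>C f x"
proof -
  fix c :: complex and f :: "'a \<Rightarrow> 'b"
  assume "bounded_linear f"
  then interpret bounded_linear f .
  have *: "c *\<^sub>C (r *\<^sub>R y) = r *\<^sub>R (c *\<^sub>C y)" for r and y :: 'b
    by (simp add: scaleR_scaleC scaleC_scaleC mult.commute)
  obtain K where K: "\<And>x. norm (f x) \<le> norm x * K"
    using bounded by blast
  show "bounded_linear (\<lambda>x. c *\<^sub>C f x)"
  proof (rule bounded_linear_intro[where K = "cmod c * K"])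
    show "norm (c *\<^sub>C f x) \<le> norm x * (cmod c * K)" for x
      using mult_left_mono[OF K[of x], of "cmod c"] by (simp add: norm_scaleC algebra_simps)
  qed (simp_all add: add scale scaleC_add_right *)
qed

instance
proof
  fix c d :: complex and f g :: "'a \<Rightarrow>\<^sub>L 'b" and r :: real
  show "c *\<^sub>C (f + g) = c *\<^sub>C f + c *\<^sub>C g"
    by transfer (simp add: scaleC_add_right)
  show "(c + d) *\<^sub>C f = c *\<^sub>C f + d *\<^sub>C f"
    by transfer (simp add: scaleC_add_left)
  show "c *\<^sub>C (d *\<^sub>C f) = (c * d) *\<^sub>C f"
    by transfer (simp add: scaleC_scaleC)
  show "1 *\<^sub>C f = f"
    by transfer (simp add: scaleC_one)
  show "r *\<^sub>R f = complex_of_real r *\<^sub>C f"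
    by transfer (simp add: scaleR_scaleC)
  show "norm (c *\<^sub>C f) = cmod c * norm f"
  proof (rule antisym)
    have le: "norm (d *\<^sub>C h) \<le> cmod d * norm h" for d and h :: "'a \<Rightarrow>\<^sub>L 'b"
    proof (rule norm_blinfun_bound)
      fix x
      have "norm (blinfun_apply (d *\<^sub>C h) x) = cmod d * norm (blinfun_apply h x)"
        by (simp add: scaleC_blinfun.rep_eq norm_scaleC)
      also have "\<dots> \<le> cmod d * (norm h * norm x)"
        by (intro mult_left_mono norm_blinfun) simp
      finally show "norm (blinfun_apply (d *\<^sub>C h) x) \<le> cmod d * norm h * norm x"
        by (simp add: mult.assoc)
    qed simp
    show "norm (c *\<^sub>C f) \<le> cmod c * norm f" by (rule le)
    show "cmod c * norm f \<le> norm (c *\<^sub>C f)"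
    proof (cases "c = 0")
      case False
      have "f = inverse c *\<^sub>C (c *\<^sub>C f)"
        using False by transfer (simp add: scaleC_scaleC scaleC_one)
      then have "norm f \<le> cmod (inverse c) * norm (c *\<^sub>C f)"
        using le[of "inverse c" "c *\<^sub>C f"] by simp
      then show ?thesis
        using False by (simp add: norm_divide norm_inverse field_simps)
    qed simp
  qed
qed

end


section \<open>C*-algebras and C*-trings\<close>

text \<open>C*-algebras are not required to have a unit.\<close>

class cstar_algebra = complex_normed_vector + real_normed_algebra + banach +
  fixes star :: "'a \<Rightarrow> 'a"
  assumes mult_scaleC_left: "(c *\<^sub>C a) * b = c *\<^sub>C (a * b)"
    and mult_scaleC_right: "a * (c *\<^sub>C b) = c *\<^sub>C (a * b)"
    and star_star: "star (star a) = a"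
    and star_add: "star (a + b) = star a + star b"
    and star_scaleC: "star (c *\<^sub>C a) = cnj c *\<^sub>C star a"
    and star_mult: "star (a * b) = star b * star a"
    and norm_star_mult_self: "norm (star a * a) = (norm a)\<^sup>2"

definition star_hom :: "('a::cstar_algebra \<Rightarrow> 'b::cstar_algebra) \<Rightarrow> bool" where
  "star_hom f \<longleftrightarrow> clinear f \<and> (\<forall>a b. f (a * b) = f a * f b) \<and> (\<forall>a. f (star a) = star (f a))"

class star_tring = complex_vector +
  fixes tprod :: "'a \<Rightarrow> 'a \<Rightarrow> 'a \<Rightarrow> 'a"
  assumes tprod_add_1: "tprod (x + x') y z = tprod x y z + tprod x' y z"
    and tprod_scaleC_1: "tprod (c *\<^sub>C x) y z = c *\<^sub>C tprod x y z"
    and tprod_add_2: "tprod x (y + y') z = tprod x y z + tprod x y' z"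
    and tprod_scaleC_2: "tprod x (c *\<^sub>C y) z = cnj c *\<^sub>C tprod x y z"
    and tprod_add_3: "tprod x y (z + z') = tprod x y z + tprod x y z'"
    and tprod_scaleC_3: "tprod x y (c *\<^sub>C z) = c *\<^sub>C tprod x y z"
    and tprod_assoc_2: "tprod (tprod x y z) u v = tprod x (tprod u z y) v"
    and tprod_assoc_3: "tprod (tprod x y z) u v = tprod x y (tprod z u v)"

class cstar_tring = star_tring + complex_normed_vector + banach +
  assumes norm_tprod_le: "norm (tprod x y z) \<le> norm x * norm y * norm z"
    and norm_tprod_self: "norm (tprod x x x) = norm x ^ 3"

definition tring_hom :: "('a::star_tring \<Rightarrow> 'b::star_tring) \<Rightarrow> bool" where
  "tring_hom \<pi> \<longleftrightarrow> clinear \<pi> \<and> (\<forall>x y z. \<pi> (tprod x y z) = tprod (\<pi> x) (\<pi> y) (\<pi> z))"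


section \<open>The operators generating the right C*-algebra of a C*-tring\<close>

lift_definition right_op :: "'a::cstar_tring \<Rightarrow> 'a \<Rightarrow> 'a \<Rightarrow>\<^sub>L 'a"
  is "\<lambda>y z x. tprod x y z"
proof -
  fix y z :: 'a
  show "bounded_linear (\<lambda>x. tprod x y z)"
    by (rule bounded_linear_intro[where K = "norm y * norm z"])
      (use norm_tprod_le in \<open>simp_all add: tprod_add_1 scaleR_scaleC tprod_scaleC_1 mult.assoc\<close>)
qed

definition right_ops :: "('a::cstar_tring \<Rightarrow>\<^sub>L 'a) set" where
  "right_ops = cspan {right_op y z | y z. True}"

lemma tprod_zero [simp]: "tprod 0 y z = 0" "tprod x 0 z = 0" "tprod x y 0 = 0"
  for x y z :: "'a::star_tring"
  using tprod_add_1[of 0 0 y z] tprod_add_2[of x 0 0 z] tprod_add_3[of x y 0 0] by simp_all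

lemma scaleC_minus_one: "(-1) *\<^sub>C x = - x" for x :: "'a::complex_vector"
  using scaleR_scaleC[of "-1" x] by simp

lemma right_ops_tprod:
  assumes "a \<in> (right_ops :: ('a::cstar_tring \<Rightarrow>\<^sub>L 'a) set)"
  shows "blinfun_apply a (tprod x u v) = tprod x u (blinfun_apply a v)"
  using assms unfolding right_ops_def
proof (induction rule: complex_vector.span_induct_alt)
  case base
  then show ?case by simp
next
  case (step c b a)
  then obtain y z where b: "b = right_op y z" by auto
  show ?case
    using step b by (simp add: plus_blinfun.rep_eq scaleC_blinfun.rep_eq tprod_add_3 tprod_scaleC_3
        right_op.rep_eq tprod_assoc_3)
qed

interpretation blinfun_comp: bounded_bilinear "(o\<^sub>L)"
  by (rule bounded_bilinear_blinfun_compose)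

lemma right_op_in: "right_op y z \<in> right_ops"
  unfolding right_ops_def by (rule complex_vector.span_base) blast

lemma right_ops_add: "a \<in> right_ops \<Longrightarrow> b \<in> right_ops \<Longrightarrow> a + b \<in> right_ops"
  unfolding right_ops_def by (rule complex_vector.span_add)

lemma right_ops_diff: "a \<in> right_ops \<Longrightarrow> b \<in> right_ops \<Longrightarrow> a - b \<in> right_ops"
  unfolding right_ops_def by (rule complex_vector.span_diff)

lemma right_ops_scaleC: "a \<in> right_ops \<Longrightarrow> c *\<^sub>C a \<in> right_ops"
  unfolding right_ops_def by (rule complex_vector.span_scale)

lemma right_ops_zero: "0 \<in> right_ops"
  unfolding right_ops_def by (rule complex_vector.span_zero)

lemma right_ops_compose:
  assumes "a \<in> right_ops" "b \<in> (right_ops :: ('a::cstar_tring \<Rightarrow>\<^sub>L 'a) set)"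
  shows "b o\<^sub>L a \<in> right_ops"
  using assms(1) unfolding right_ops_def
proof (induction rule: complex_vector.span_induct_alt)
  case base
  then show ?case by (simp add: complex_vector.span_zero blinfun_compose_zero)
next
  case (step c g a)
  then obtain y z where g: "g = right_op y z" by auto
  have "b o\<^sub>L g = right_op y (blinfun_apply b z)"
    by (rule blinfun_eqI) (simp add: g right_op.rep_eq right_ops_tprod[OF assms(2)])
  moreover have "b o\<^sub>L (c *\<^sub>C g) = c *\<^sub>C (b o\<^sub>L g)"
  proof (rule blinfun_eqI)
    have "blinfun_apply b (c *\<^sub>C x) = c *\<^sub>C blinfun_apply b x" for x
      using assms(2) unfolding right_ops_def
    proof (induction rule: complex_vector.span_induct_alt)
      case base
      then show ?case by simp
    next
      case (step d h k)
      then show ?case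
        by (auto simp: plus_blinfun.rep_eq scaleC_blinfun.rep_eq right_op.rep_eq tprod_scaleC_1
            scaleC_add_right scaleC_scaleC mult.commute)
    qed
    then show "blinfun_apply (b o\<^sub>L (c *\<^sub>C g)) x = blinfun_apply (c *\<^sub>C (b o\<^sub>L g)) x" for x
      by (simp add: scaleC_blinfun.rep_eq)
  qed
  ultimately have "b o\<^sub>L (c *\<^sub>C g + a) = c *\<^sub>C right_op y (blinfun_apply b z) + (b o\<^sub>L a)"
    by (simp add: blinfun_comp.add_right)
  moreover have "b o\<^sub>L a \<in> right_ops"
    using step by (simp add: right_ops_def)
  ultimately have "b o\<^sub>L (c *\<^sub>C g + a) \<in> right_ops"
    by (simp add: right_ops_add right_ops_scaleC right_op_in)
  then show ?case by (simp add: right_ops_def)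
qed

definition adjoint_ops :: "('a::cstar_tring \<Rightarrow>\<^sub>L 'a) \<Rightarrow> ('a \<Rightarrow>\<^sub>L 'a) \<Rightarrow> bool" where
  "adjoint_ops a b \<longleftrightarrow>
     (\<forall>x w v. tprod (blinfun_apply a x) w v = tprod x (blinfun_apply b w) v) \<and>
     (\<forall>x w v. tprod (blinfun_apply b x) w v = tprod x (blinfun_apply a w) v)"

lemma adjoint_ops_sym: "adjoint_ops a b \<Longrightarrow> adjoint_ops b a"
  by (auto simp: adjoint_ops_def)

lemma adjoint_ops_right_op: "adjoint_ops (right_op y z) (right_op z y)"
  by (simp add: adjoint_ops_def right_op.rep_eq tprod_assoc_2)

lemma adjoint_ops_add:
  "adjoint_ops a b \<Longrightarrow> adjoint_ops a' b' \<Longrightarrow> adjoint_ops (a + a') (b + b')"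
  by (simp add: adjoint_ops_def plus_blinfun.rep_eq tprod_add_1 tprod_add_2)

lemma adjoint_ops_scaleC: "adjoint_ops a b \<Longrightarrow> adjoint_ops (c *\<^sub>C a) (cnj c *\<^sub>C b)"
  by (simp add: adjoint_ops_def scaleC_blinfun.rep_eq tprod_scaleC_1 tprod_scaleC_2)

lemma adjoint_ops_diff:
  assumes "adjoint_ops a b" "adjoint_ops a' b'"
  shows "adjoint_ops (a - a') (b - b')"
proof -
  have "adjoint_ops (a + (-1) *\<^sub>C a') (b + cnj (-1) *\<^sub>C b')"
    by (intro adjoint_ops_add adjoint_ops_scaleC assms)
  then show ?thesis by (simp add: scaleC_minus_one)
qed

lemma adjoint_ops_zero: "adjoint_ops 0 0"
  by (simp add: adjoint_ops_def)

lemma adjoint_ops_compose: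
  "adjoint_ops a b \<Longrightarrow> adjoint_ops a' b' \<Longrightarrow> adjoint_ops (a' o\<^sub>L a) (b o\<^sub>L b')"
  by (simp add: adjoint_ops_def)

lemma adjoint_ops_norm_sq:
  assumes "adjoint_ops a b"
  shows "(norm a)\<^sup>2 \<le> norm (b o\<^sub>L a)"
proof -
  have *: "norm (blinfun_apply a x) \<le> sqrt (norm (b o\<^sub>L a)) * norm x" for x
  proof (cases "blinfun_apply a x = 0")
    case False
    let ?u = "blinfun_apply a x"
    have "norm ?u ^ 3 = norm (tprod ?u ?u ?u)"
      by (simp add: norm_tprod_self)
    also have "tprod ?u ?u ?u = tprod x (blinfun_apply b ?u) ?u"
      using assms by (simp add: adjoint_ops_def)
    also have "norm \<dots> \<le> norm x * norm (blinfun_apply (b o\<^sub>L a) x) * norm ?u"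
      using norm_tprod_le by simp
    also have "\<dots> \<le> norm x * (norm (b o\<^sub>L a) * norm x) * norm ?u"
      by (intro mult_left_mono mult_right_mono norm_blinfun) auto
    finally have "(norm ?u)\<^sup>2 * norm ?u \<le> norm (b o\<^sub>L a) * (norm x)\<^sup>2 * norm ?u"
      by (simp add: power2_eq_square power3_eq_cube algebra_simps)
    then have "(norm ?u)\<^sup>2 \<le> norm (b o\<^sub>L a) * (norm x)\<^sup>2"
      using False by simp
    then have "norm ?u \<le> sqrt (norm (b o\<^sub>L a) * (norm x)\<^sup>2)"
      by (rule real_le_rsqrt)
    then show ?thesis by (simp add: real_sqrt_mult)
  qed simp
  have "norm a \<le> sqrt (norm (b o\<^sub>L a))"
    by (rule norm_blinfun_bound) (simp, rule *)
  then have "(norm a)\<^sup>2 \<le> (sqrt (norm (b o\<^sub>L a)))\<^sup>2"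
    by (rule power_mono) simp
  then show ?thesis by simp
qed

lemma adjoint_ops_norm_le: "adjoint_ops a b \<Longrightarrow> norm a \<le> norm b"
proof (cases "a = 0")
  case False
  assume "adjoint_ops a b"
  then have "norm a * norm a \<le> norm b * norm a"
    using adjoint_ops_norm_sq[of a b] norm_blinfun_compose[of b a] by (simp add: power2_eq_square)
  then show ?thesis using False by simp
qed simp

lemma adjoint_ops_norm: "adjoint_ops a b \<Longrightarrow> norm a = norm b"
  using adjoint_ops_norm_le adjoint_ops_sym by (metis antisym)

lemma adjoint_ops_unique: "adjoint_ops a b \<Longrightarrow> adjoint_ops a b' \<Longrightarrow> b = b'"
  using adjoint_ops_norm[OF adjoint_ops_diff[of a b a b']] by simp

lemma adjoint_ops_cstar:
  assumes "adjoint_ops a b"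
  shows "norm (b o\<^sub>L a) = (norm a)\<^sup>2"
proof (rule antisym)
  show "norm (b o\<^sub>L a) \<le> (norm a)\<^sup>2"
    using norm_blinfun_compose[of b a] adjoint_ops_norm[OF assms] by (simp add: power2_eq_square)
qed (rule adjoint_ops_norm_sq[OF assms])

lemma right_ops_adjoint:
  assumes "a \<in> right_ops"
  shows "\<exists>b\<in>right_ops. adjoint_ops a b"
  using assms unfolding right_ops_def
proof (induction rule: complex_vector.span_induct_alt)
  case base
  then show ?case using adjoint_ops_zero complex_vector.span_zero by blast
next
  case (step c g a)
  then obtain y z where g: "g = right_op y z" by auto
  from step obtain b where b: "b \<in> right_ops" "adjoint_ops a b"
    by (auto simp: right_ops_def)
  have "adjoint_ops (c *\<^sub>C g + a) (cnj c *\<^sub>C right_op z y + b)"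
    unfolding g by (intro adjoint_ops_add adjoint_ops_scaleC adjoint_ops_right_op b)
  moreover have "cnj c *\<^sub>C right_op z y + b \<in> right_ops"
    by (intro right_ops_add right_ops_scaleC right_op_in b)
  ultimately show ?case by (auto simp: right_ops_def)
qed

lemma closure_right_ops_adjoint:
  assumes "a \<in> closure (right_ops :: ('a::cstar_tring \<Rightarrow>\<^sub>L 'a) set)"
  shows "\<exists>b\<in>closure right_ops. adjoint_ops a b"
proof -
  from assms obtain s where s: "\<And>n. s n \<in> right_ops" "s \<longlonglongrightarrow> a"
    by (auto simp: closure_sequential)
  obtain t where t: "\<And>n. t n \<in> right_ops" "\<And>n. adjoint_ops (s n) (t n)"
  proof -
    have "\<forall>n. \<exists>b. b \<in> right_ops \<and> adjoint_ops (s n) b"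
      using right_ops_adjoint s(1) by blast
    then show ?thesis using that by metis
  qed
  have "Cauchy s" using s(2) by (rule LIMSEQ_imp_Cauchy)
  moreover have "dist (t m) (t n) = dist (s m) (s n)" for m n
    unfolding dist_norm by (rule adjoint_ops_norm[OF adjoint_ops_diff, symmetric]) (rule t)+
  ultimately have "Cauchy t" by (simp add: Cauchy_def)
  then obtain b where b: "t \<longlonglongrightarrow> b"
    using Cauchy_convergent convergent_def by blast
  have lim: "(\<lambda>n. tprod x (blinfun_apply (p n) w) v) \<longlonglongrightarrow> tprod x (blinfun_apply q w) v"
    if "p \<longlonglongrightarrow> q" for p :: "nat \<Rightarrow> 'a \<Rightarrow>\<^sub>L 'a" and q x w v
  proof -
    have "bounded_linear (\<lambda>y. tprod x y v)"
      by (rule bounded_linear_intro[where K = "norm x * norm v"])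
        (use norm_tprod_le[of x _ v] in \<open>simp_all add: tprod_add_2 scaleR_scaleC tprod_scaleC_2 ac_simps\<close>)
    then show ?thesis
      by (rule bounded_linear.tendsto) (intro tendsto_intros that)
  qed
  have lim': "(\<lambda>n. tprod (blinfun_apply (p n) x) w v) \<longlonglongrightarrow> tprod (blinfun_apply q x) w v"
    if "p \<longlonglongrightarrow> q" for p :: "nat \<Rightarrow> 'a \<Rightarrow>\<^sub>L 'a" and q x w v
  proof -
    have "bounded_linear (\<lambda>y. tprod y w v)"
      using blinfun.bounded_linear_right[of "right_op w v"] by (simp add: right_op.rep_eq)
    then show ?thesis
      by (rule bounded_linear.tendsto) (intro tendsto_intros that)
  qed
  have "adjoint_ops a b"
    unfolding adjoint_ops_def
  proof (intro conjI allI)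
    fix x w v
    have "(\<lambda>n. tprod (blinfun_apply (s n) x) w v) = (\<lambda>n. tprod x (blinfun_apply (t n) w) v)"
      and "(\<lambda>n. tprod (blinfun_apply (t n) x) w v) = (\<lambda>n. tprod x (blinfun_apply (s n) w) v)"
      using t(2) by (auto simp: adjoint_ops_def)
    then show "tprod (blinfun_apply a x) w v = tprod x (blinfun_apply b w) v"
      and "tprod (blinfun_apply b x) w v = tprod x (blinfun_apply a w) v"
      using lim'[OF s(2)] lim[OF b] lim'[OF b] lim[OF s(2)] by (metis LIMSEQ_unique)+
  qed
  moreover have "b \<in> closure right_ops"
    using t(1) b by (auto simp: closure_sequential)
  ultimately show ?thesis by blast
qed

lemma closure_right_ops_add:
  assumes "a \<in> closure right_ops" "b \<in> closure right_ops"
  shows "a + b \<in> closure right_ops"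
proof -
  from assms obtain s t where "\<And>n. s n \<in> right_ops" "s \<longlonglongrightarrow> a" "\<And>n. t n \<in> right_ops" "t \<longlonglongrightarrow> b"
    by (auto simp: closure_sequential)
  then show ?thesis
    unfolding closure_sequential
    by (intro exI[of _ "\<lambda>n. s n + t n"]) (auto intro: right_ops_add tendsto_add)
qed

lemma closure_right_ops_compose:
  assumes "a \<in> closure right_ops" "b \<in> closure right_ops"
  shows "b o\<^sub>L a \<in> closure right_ops"
proof -
  from assms obtain s t where "\<And>n. s n \<in> right_ops" "s \<longlonglongrightarrow> a" "\<And>n. t n \<in> right_ops" "t \<longlonglongrightarrow> b"
    by (auto simp: closure_sequential)
  then show ?thesis
    unfolding closure_sequential
    by (intro exI[of _ "\<lambda>n. t n o\<^sub>L s n"]) (auto intro: right_ops_compose blinfun_comp.tendsto)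
qed

lemma bounded_linear_scaleC: "bounded_linear (\<lambda>x::'a::complex_normed_vector. c *\<^sub>C x)"
  by (rule bounded_linear_intro[where K = "cmod c"])
    (simp_all add: scaleC_add_right scaleR_scaleC scaleC_scaleC norm_scaleC mult.commute)

lemma closure_right_ops_scaleC:
  assumes "a \<in> closure right_ops"
  shows "c *\<^sub>C a \<in> closure right_ops"
proof -
  from assms obtain s where "\<And>n. s n \<in> right_ops" "s \<longlonglongrightarrow> a"
    by (auto simp: closure_sequential)
  then show ?thesis
    unfolding closure_sequential
    by (intro exI[of _ "\<lambda>n. c *\<^sub>C s n"])
      (auto intro: right_ops_scaleC bounded_linear.tendsto[OF bounded_linear_scaleC])
qed

lemma closure_right_ops_zero: "0 \<in> closure right_ops"
  using right_ops_zero closure_subset by blast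

lemma closure_right_ops_scaleR: "a \<in> closure right_ops \<Longrightarrow> r *\<^sub>R a \<in> closure right_ops"
  by (simp add: scaleR_scaleC closure_right_ops_scaleC)

lemma closure_right_ops_minus: "a \<in> closure right_ops \<Longrightarrow> - a \<in> closure right_ops"
  using closure_right_ops_scaleR[of a "-1"] by simp

lemma closure_right_ops_diff:
  "a \<in> closure right_ops \<Longrightarrow> b \<in> closure right_ops \<Longrightarrow> a - b \<in> closure right_ops"
  using closure_right_ops_add[of a "- b"] closure_right_ops_minus[of b] by simp

lemma blinfun_compose_scaleC_left: "(c *\<^sub>C b) o\<^sub>L a = c *\<^sub>C (b o\<^sub>L a)"
  by (rule blinfun_eqI) (simp add: scaleC_blinfun.rep_eq)

lemma blinfun_compose_scaleC_right:
  assumes "b \<in> closure (right_ops :: ('a::cstar_tring \<Rightarrow>\<^sub>L 'a) set)"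
  shows "b o\<^sub>L (c *\<^sub>C a) = c *\<^sub>C (b o\<^sub>L a)"
proof -
  obtain d where d: "adjoint_ops b d" using closure_right_ops_adjoint[OF assms] by blast
  have "blinfun_apply b (c *\<^sub>C x) = c *\<^sub>C blinfun_apply b x" for x
  proof -
    let ?u = "blinfun_apply b (c *\<^sub>C x) - c *\<^sub>C blinfun_apply b x"
    have tdiff: "tprod (p - q) w v = tprod p w v - tprod q w v" for p q w v :: 'a
      using tprod_add_1[of "p - q" q w v] by simp
    have "tprod ?u w v = 0" for w v
      using d by (simp add: tdiff tprod_scaleC_1 adjoint_ops_def)
    then have "norm ?u ^ 3 = 0"
      by (metis norm_tprod_self norm_zero)
    then show ?thesis by simp
  qed
  then show ?thesis
    by (intro blinfun_eqI) (simp add: scaleC_blinfun.rep_eq)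
qed


section \<open>The right C*-algebra of a C*-tring\<close>

text \<open>
  Since \<^typ>\<open>'a \<Rightarrow>\<^sub>L 'a\<close> is complete in the operator norm, the closure of the span of the
  operators \<^term>\<open>right_op y z\<close> is their completion.
\<close>

typedef (overloaded) 'a right_algebra = "closure (right_ops :: ('a::cstar_tring \<Rightarrow>\<^sub>L 'a) set)"
  morphisms op_of Abs_right_algebra
  using closure_right_ops_zero by blast

setup_lifting type_definition_right_algebra

lift_definition rbracket :: "'a::cstar_tring \<Rightarrow> 'a \<Rightarrow> 'a right_algebra" is right_op
  using right_op_in closure_subset by blast

instantiation right_algebra :: (cstar_tring) complex_normed_vector
begin

lift_definition zero_right_algebra :: "'a right_algebra" is 0
  by (rule closure_right_ops_zero)
lift_definition plus_right_algebra :: "'a right_algebra \<Rightarrow> 'a right_algebra \<Rightarrow> 'a right_algebra" is "(+)"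
  by (rule closure_right_ops_add)
lift_definition minus_right_algebra :: "'a right_algebra \<Rightarrow> 'a right_algebra \<Rightarrow> 'a right_algebra" is "(-)"
  by (rule closure_right_ops_diff)
lift_definition uminus_right_algebra :: "'a right_algebra \<Rightarrow> 'a right_algebra" is uminus
  by (rule closure_right_ops_minus)
lift_definition scaleR_right_algebra :: "real \<Rightarrow> 'a right_algebra \<Rightarrow> 'a right_algebra" is "(*\<^sub>R)"
  by (rule closure_right_ops_scaleR)
lift_definition scaleC_right_algebra :: "complex \<Rightarrow> 'a right_algebra \<Rightarrow> 'a right_algebra" is "(*\<^sub>C)"
  by (rule closure_right_ops_scaleC)
lift_definition norm_right_algebra :: "'a right_algebra \<Rightarrow> real" is norm .

definition dist_right_algebra :: "'a right_algebra \<Rightarrow> 'a right_algebra \<Rightarrow> real"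
  where "dist_right_algebra a b = norm (a - b)"
definition sgn_right_algebra :: "'a right_algebra \<Rightarrow> 'a right_algebra"
  where "sgn_right_algebra a = inverse (norm a) *\<^sub>R a"
definition [code del]:
  "(uniformity :: ('a right_algebra \<times> 'a right_algebra) filter) =
     (INF e\<in>{0 <..}. principal {(x, y). dist x y < e})"
definition open_right_algebra :: "'a right_algebra set \<Rightarrow> bool"
  where [code del]: "open_right_algebra S = (\<forall>x\<in>S. \<forall>\<^sub>F (x', y) in uniformity. x' = x \<longrightarrow> y \<in> S)"

instance
proof
  fix a b c :: "'a right_algebra" and r s :: real and u v :: complex and S :: "'a right_algebra set"
  show "a + b + c = a + (b + c)" by transfer (simp add: add.assoc)
  show "a + b = b + a" by transfer (simp add: add.commute)
  show "0 + a = a" by transfer simp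
  show "- a + a = 0" by transfer simp
  show "a - b = a + - b" by transfer simp
  show "r *\<^sub>R (a + b) = r *\<^sub>R a + r *\<^sub>R b" by transfer (simp add: scaleR_right_distrib)
  show "(r + s) *\<^sub>R a = r *\<^sub>R a + s *\<^sub>R a" by transfer (simp add: scaleR_left_distrib)
  show "r *\<^sub>R s *\<^sub>R a = (r * s) *\<^sub>R a" by transfer simp
  show "1 *\<^sub>R a = a" by transfer simp
  show "u *\<^sub>C (a + b) = u *\<^sub>C a + u *\<^sub>C b" by transfer (rule scaleC_add_right)
  show "(u + v) *\<^sub>C a = u *\<^sub>C a + v *\<^sub>C a" by transfer (rule scaleC_add_left)
  show "u *\<^sub>C v *\<^sub>C a = (u * v) *\<^sub>C a" by transfer (rule scaleC_scaleC)
  show "1 *\<^sub>C a = a" by transfer (rule scaleC_one)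
  show "r *\<^sub>R a = complex_of_real r *\<^sub>C a" by transfer (rule scaleR_scaleC)
  show "dist a b = norm (a - b)" by (rule dist_right_algebra_def)
  show "sgn a = inverse (norm a) *\<^sub>R a" by (rule sgn_right_algebra_def)
  show "uniformity = (INF e\<in>{0 <..}. principal {(x, y :: 'a right_algebra). dist x y < e})"
    by (rule uniformity_right_algebra_def)
  show "open S = (\<forall>x\<in>S. \<forall>\<^sub>F (x', y) in uniformity. x' = x \<longrightarrow> y \<in> S)"
    by (rule open_right_algebra_def)
  show "(norm a = 0) = (a = 0)" by transfer simp
  show "norm (a + b) \<le> norm a + norm b" by transfer (rule norm_triangle_ineq)
  show "norm (r *\<^sub>R a) = \<bar>r\<bar> * norm a" by transfer simp
  show "norm (u *\<^sub>C a) = cmod u * norm a" by transfer (rule norm_scaleC)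
qed

end

text \<open>The span of the brackets is the algebraic part, and it is dense.\<close>

lemma op_of_image_cspan: "op_of ` cspan {rbracket y z | y z :: 'a::cstar_tring. True} = right_ops"
proof -
  have "module_hom scaleC scaleC (op_of :: 'a right_algebra \<Rightarrow> _)"
    by unfold_locales
      (simp_all add: plus_right_algebra.rep_eq scaleC_right_algebra.rep_eq)
  then have "op_of ` cspan {rbracket y z | y z :: 'a. True}
      = cspan (op_of ` {rbracket y z | y z :: 'a. True})"
    unfolding cspan_raw_def by (simp add: module_hom.span_image)
  also have "op_of ` {rbracket y z | y z :: 'a. True} = {right_op y z | y z. True}"
    by (auto simp: image_iff simp flip: rbracket.rep_eq)
  finally show ?thesis by (simp add: right_ops_def)
qed

lemma closure_cspan_rbracket: "closure (cspan {rbracket y z | y z :: 'a::cstar_tring. True}) = UNIV"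
proof -
  have "a \<in> closure (cspan {rbracket y z | y z :: 'a. True})" for a
  proof -
    obtain s where s: "\<And>n. s n \<in> right_ops" "s \<longlonglongrightarrow> op_of a"
      using op_of[of a] by (auto simp: closure_sequential)
    obtain t where t: "\<And>n. t n \<in> cspan {rbracket y z | y z :: 'a. True}" "\<And>n. op_of (t n) = s n"
      using s(1) unfolding op_of_image_cspan[symmetric] image_iff by metis
    have "t \<longlonglongrightarrow> a"
      using s(2) unfolding tendsto_iff dist_norm
      by (simp add: norm_right_algebra.rep_eq minus_right_algebra.rep_eq t(2))
    then show ?thesis using t(1) by (auto simp: closure_sequential)
  qed
  then show ?thesis by blast
qed

text \<open>
  The involution is determined on the span of the brackets by \<open>\<langle>y, z\<rangle>* = \<langle>z, y\<rangle>\<close> and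
  conjugate linearity, and on the completion by continuity. The product is opposite to composition
  because the algebra acts on the right: \<open>x (a b) = (x a) b\<close>.
\<close>

definition bracket_swap :: "('a::cstar_tring right_algebra \<Rightarrow> 'a right_algebra) \<Rightarrow> bool" where
  "bracket_swap f \<longleftrightarrow> continuous_on UNIV f \<and>
     (\<forall>a b. f (a + b) = f a + f b) \<and> (\<forall>c a. f (c *\<^sub>C a) = cnj c *\<^sub>C f a) \<and>
     (\<forall>y z. f (rbracket y z) = rbracket z y)"

lemma bracket_swap_unique:
  assumes "bracket_swap f" "bracket_swap (g :: 'a::cstar_tring right_algebra \<Rightarrow> _)"
  shows "f = g"
proof
  fix a :: "'a right_algebra"
  have zero: "h 0 = 0" if "bracket_swap h" for h :: "'a right_algebra \<Rightarrow> 'a right_algebra"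
    using that unfolding bracket_swap_def by (metis add_cancel_right_left add_0)
  have eq: "f b = g b" if "b \<in> cspan {rbracket y z | y z. True}" for b
    using that
  proof (induction rule: complex_vector.span_induct_alt)
    case base
    then show ?case using zero[OF assms(1)] zero[OF assms(2)] by simp
  next
    case (step c b a)
    then show ?case using assms by (auto simp: bracket_swap_def)
  qed
  have "closed {b. f b = g b}"
    using assms by (intro closed_Collect_eq) (auto simp: bracket_swap_def)
  then have "closure (cspan {rbracket y z | y z. True}) \<subseteq> {b. f b = g b}"
    by (intro closure_minimal) (use eq in auto)
  then show "f a = g a" using closure_cspan_rbracket by blast
qed

lemma bracket_swap_exists:
  "\<exists>f. bracket_swap (f :: 'a::cstar_tring right_algebra \<Rightarrow> _) \<and>
       (\<forall>a. adjoint_ops (op_of a) (op_of (f a)))"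
proof -
  have "\<exists>b. adjoint_ops (op_of a) (op_of b)" for a :: "'a right_algebra"
    using closure_right_ops_adjoint[OF op_of[of a]] by (metis op_of_cases)
  then obtain f where f: "\<And>a :: 'a right_algebra. adjoint_ops (op_of a) (op_of (f a))"
    by metis
  have eqI: "f a = b" if "adjoint_ops (op_of a) (op_of b)" for a b
    using adjoint_ops_unique[OF f that] by (simp add: op_of_inject)
  have add: "f (a + b) = f a + f b" for a b
    by (rule eqI) (simp add: plus_right_algebra.rep_eq adjoint_ops_add f)
  have scale: "f (c *\<^sub>C a) = cnj c *\<^sub>C f a" for c a
    by (rule eqI) (simp add: scaleC_right_algebra.rep_eq adjoint_ops_scaleC f)
  have "bounded_linear f"
    by (rule bounded_linear_intro[where K = 1])
      (simp_all add: add scale scaleR_scaleC norm_right_algebra.rep_eq adjoint_ops_norm[OF f, symmetric])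
  then have "continuous_on UNIV f"
    by (rule linear_continuous_on)
  moreover have "f (rbracket y z) = rbracket z y" for y z
    by (rule eqI) (simp add: rbracket.rep_eq adjoint_ops_right_op)
  ultimately show ?thesis
    using add scale f unfolding bracket_swap_def by blast
qed

instantiation right_algebra :: (cstar_tring) cstar_algebra
begin

lift_definition times_right_algebra :: "'a right_algebra \<Rightarrow> 'a right_algebra \<Rightarrow> 'a right_algebra"
  is "\<lambda>a b. b o\<^sub>L a"
  by (rule closure_right_ops_compose)

definition star_right_algebra :: "'a right_algebra \<Rightarrow> 'a right_algebra" where
  "star_right_algebra = (THE f. bracket_swap f)"

lemma bracket_swap_star: "bracket_swap (star :: 'a right_algebra \<Rightarrow> _)"
  and adjoint_ops_star: "adjoint_ops (op_of a) (op_of (star a))" for a :: "'a right_algebra"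
proof -
  obtain f where f: "bracket_swap (f :: 'a right_algebra \<Rightarrow> _)"
      "\<And>a. adjoint_ops (op_of a) (op_of (f a))"
    using bracket_swap_exists by blast
  then have "star = f"
    unfolding star_right_algebra_def by (intro the_equality bracket_swap_unique)
  then show "bracket_swap (star :: 'a right_algebra \<Rightarrow> _)" "adjoint_ops (op_of a) (op_of (star a))"
    using f by auto
qed

instance
proof
  fix a b c :: "'a right_algebra" and r :: real and u :: complex
  show "a * b * c = a * (b * c)" by transfer (simp add: blinfun_eqI)
  show "(a + b) * c = a * c + b * c" by transfer (rule blinfun_comp.add_right)
  show "a * (b + c) = a * b + a * c" by transfer (rule blinfun_comp.add_left)
  show "r *\<^sub>R a * b = r *\<^sub>R (a * b)" by transfer (rule blinfun_comp.scaleR_right)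
  show "a * r *\<^sub>R b = r *\<^sub>R (a * b)" by transfer (rule blinfun_comp.scaleR_left)
  show "norm (a * b) \<le> norm a * norm b"
    by transfer (metis norm_blinfun_compose mult.commute)
  show "u *\<^sub>C a * b = u *\<^sub>C (a * b)" by transfer (rule blinfun_compose_scaleC_right)
  show "a * u *\<^sub>C b = u *\<^sub>C (a * b)" by transfer (rule blinfun_compose_scaleC_left)
  have eqI: "star a = b" if "adjoint_ops (op_of a) (op_of b)" for a b :: "'a right_algebra"
    using adjoint_ops_unique[OF adjoint_ops_star that] by (simp add: op_of_inject)
  show "star (star a) = a"
    by (rule eqI) (rule adjoint_ops_sym[OF adjoint_ops_star])
  show "star (a + b) = star a + star b" "star (u *\<^sub>C a) = cnj u *\<^sub>C star a"
    using bracket_swap_star by (auto simp: bracket_swap_def)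
  show "star (a * b) = star b * star a"
    by (rule eqI) (simp add: times_right_algebra.rep_eq adjoint_ops_compose adjoint_ops_star)
  show "norm (star a * a) = (norm a)\<^sup>2"
    using adjoint_ops_cstar[OF adjoint_ops_sym[OF adjoint_ops_star[of a]]]
      adjoint_ops_norm[OF adjoint_ops_star[of a]]
    by (simp add: times_right_algebra.rep_eq norm_right_algebra.rep_eq)
next
  fix X :: "nat \<Rightarrow> 'a right_algebra"
  assume "Cauchy X"
  then have "Cauchy (\<lambda>n. op_of (X n))"
    by (simp add: Cauchy_def dist_norm norm_right_algebra.rep_eq minus_right_algebra.rep_eq)
  then obtain l where l: "(\<lambda>n. op_of (X n)) \<longlonglongrightarrow> l"
    using Cauchy_convergent convergent_def by blast
  have "l \<in> closure right_ops"
    using closed_closure op_of l by (metis closed_sequentially)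
  then obtain a where "l = op_of a" by (metis op_of_cases)
  then have "X \<longlonglongrightarrow> a"
    using l unfolding tendsto_iff dist_norm
    by (simp add: norm_right_algebra.rep_eq minus_right_algebra.rep_eq)
  then show "convergent X" by (auto simp: convergent_def)
qed

end

lemma star_rbracket: "star (rbracket y z) = rbracket z y"
  using bracket_swap_star by (auto simp: bracket_swap_def)

text \<open>
  Multiplicativity and preservation of the involution are required on the whole of the completion;
  no continuity is imposed, as it is automatic for homomorphisms of C*-algebras.
\<close>

definition right_map ::
  "('a::cstar_tring \<Rightarrow> 'b::cstar_tring) \<Rightarrow> 'a right_algebra \<Rightarrow> 'b right_algebra" where
  "right_map \<pi> = (THE f. star_hom f \<and> (\<forall>x y. f (rbracket x y) = rbracket (\<pi> x) (\<pi> y)))"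


section \<open>Exactness\<close>

definition exact_maps :: "('a::zero \<Rightarrow> 'b::zero) \<Rightarrow> ('b \<Rightarrow> 'c::zero) \<Rightarrow> bool" where
  "exact_maps f g \<longleftrightarrow> inj f \<and> surj g \<and> {x. g x = 0} = range f"

definition tring_exact ::
  "('a::cstar_tring \<Rightarrow> 'b::cstar_tring) \<Rightarrow> ('b \<Rightarrow> 'c::cstar_tring) \<Rightarrow> bool" where
  "tring_exact \<phi> \<psi> \<longleftrightarrow> tring_hom \<phi> \<and> tring_hom \<psi> \<and> exact_maps \<phi> \<psi>"

definition cstar_exact ::
  "('a::cstar_algebra \<Rightarrow> 'b::cstar_algebra) \<Rightarrow> ('b \<Rightarrow> 'c::cstar_algebra) \<Rightarrow> bool" where
  "cstar_exact f g \<longleftrightarrow> star_hom f \<and> star_hom g \<and> exact_maps f g"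

end

theory Submission
  imports Defs
begin

text \<open>
  A *-homomorphism \<open>f\<close> defined on a star-stable right ideal is contractive: for skew-adjoint \<open>a\<close>
  with \<open>\<parallel>a\<parallel> < 1\<close> the ideal contains a \<open>k\<close> with \<open>(1 - k)\<^sup>2 = 1 + a\<^sup>2\<close>, so that \<open>f a\<close> is the
  skew-adjoint part of the unitary \<open>(1 - f k) + f a\<close>. This gives both the existence and the
  uniqueness of \<open>\<pi>\<^sup>r\<close>, and the contractivity of \<open>\<pi>\<close>. The range of a *-homomorphism of C*-algebras is
  closed, since skew-adjoint elements with a small image can be replaced, up to a small error in the
  image, by the skew-adjoint part of \<open>(1 + a/m)\<^sup>m\<close>, which is bounded. Surjectivity of \<open>\<psi>\<^sup>r\<close> follows,
  and injectivity of \<open>\<phi>\<^sup>r\<close> follows from \<open>\<phi>(x a) = \<phi>(x) \<phi>\<^sup>r(a)\<close>.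

  If \<open>\<psi>\<^sup>r(a) = 0\<close>, then \<open>\<psi>(x a) = 0\<close>, so \<open>x a \<in> \<phi>(F\<^sub>1)\<close> for all \<open>x\<close>, hence
  \<open>a\<^sup>* \<langle>y, z\<rangle> a = \<langle>y a, z a\<rangle>\<close> lies in the range of \<open>\<phi>\<^sup>r\<close>, and by density so does \<open>a\<^sup>* b a\<close> for all \<open>b\<close>. For
  skew-adjoint \<open>a\<close> this applies to \<open>a\<^sup>3\<close>, and iterating \<open>a \<mapsto> a + a\<^sup>3 / (3 \<parallel>a\<parallel>\<^sup>2)\<close>, which
  shrinks the norm by a fixed factor, shows that \<open>a\<close> itself is in this closed range.
\<close>

section \<open>C*-algebras\<close>

lemma norm_star [simp]: "norm (star a) = norm (a::'a::cstar_algebra)"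
proof -
  have le: "norm b \<le> norm (star b)" for b :: 'a
  proof (cases "b = 0")
    case False
    have "norm b * norm b \<le> norm (star b) * norm b"
      using norm_mult_ineq[of "star b" b] by (simp add: norm_star_mult_self power2_eq_square)
    then show ?thesis using False by simp
  qed simp
  show ?thesis
    using le[of a] le[of "star a"] by (simp add: star_star)
qed

lemma star_scaleR: "star (r *\<^sub>R a) = r *\<^sub>R star (a::'a::cstar_algebra)"
  by (simp add: scaleR_scaleC star_scaleC)

lemma bounded_linear_star: "bounded_linear (star :: 'a::cstar_algebra \<Rightarrow> 'a)"
  by (rule bounded_linear_intro[where K = 1]) (simp_all add: star_add star_scaleR)

lemmas star_zero [simp] = linear_simps(3)[OF bounded_linear_star]
  and star_minus = linear_simps(4)[OF bounded_linear_star]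
  and star_diff = linear_simps(2)[OF bounded_linear_star]
  and tendsto_star = bounded_linear.tendsto[OF bounded_linear_star]

lemma star_mult_self_eq_0: "star a * a = 0 \<Longrightarrow> a = (0::'a::cstar_algebra)"
  using norm_star_mult_self[of a] by simp

text \<open>The formulas for \<open>b\<close> and \<open>c\<close> are part of the conclusion
  because norm bounds for their images and their membership in a kernel are read off from
  them.\<close>

lemma decompose_skew:
  fixes a :: "'a::cstar_algebra"
  obtains b c where "a = b + \<i> *\<^sub>C c" "star b = - b" "star c = - c"
    and "b = (1/2) *\<^sub>R (a - star a)" "c = (- \<i> / 2) *\<^sub>C (a + star a)"
proof
  let ?b = "(1/2) *\<^sub>R (a - star a)" and ?c = "(- \<i> / 2) *\<^sub>C (a + star a)"
  have "\<i> *\<^sub>C ?c = (1/2) *\<^sub>R (a + star a)"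
    by (simp add: scaleC_scaleC scaleR_scaleC)
  moreover have "(1/2) *\<^sub>R (a - star a) + (1/2) *\<^sub>R (a + star a) = a"
    by (simp add: algebra_simps flip: scaleR_add_left)
  ultimately show "a = ?b + \<i> *\<^sub>C ?c"
    by simp
  show "star ?b = - ?b"
    by (simp add: star_scaleR star_diff star_star algebra_simps)
  have "star ?c = (\<i> / 2) *\<^sub>C (a + star a)"
    by (subst star_scaleC) (simp add: star_add star_star add.commute)
  also have "\<dots> = - ?c"
    by simp
  finally show "star ?c = - ?c" .
qed auto

text \<open>Left multiplication by \<open>1 + d\<close> is used in place of a unit.\<close>

lemma norm_add_mult_sq:
  fixes d x :: "'a::cstar_algebra"
  shows "(norm (x + d * x))\<^sup>2 \<le> (1 + norm (d + star d + star d * d)) * (norm x)\<^sup>2"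
proof -
  \<comment> \<open>This is (1 + d)^* (1 + d) - 1, multiplied out; it vanishes when 1 + d is an
    isometry.\<close>
  let ?e = "d + star d + star d * d"
  have "star (x + d * x) * (x + d * x) = star x * x + star x * (?e * x)"
    by (simp add: star_add star_mult algebra_simps)
  then have "(norm (x + d * x))\<^sup>2 = norm (star x * x + star x * (?e * x))"
    by (metis norm_star_mult_self)
  also have "\<dots> \<le> norm (star x * x) + norm (star x * (?e * x))"
    by (rule norm_triangle_ineq)
  also have "norm (star x * (?e * x)) \<le> norm (star x) * (norm ?e * norm x)"
    by (rule order_trans[OF norm_mult_ineq]) (intro mult_left_mono norm_mult_ineq norm_ge_zero)
  finally show ?thesis
    by (simp add: norm_star_mult_self power2_eq_square algebra_simps)
qed

text \<open>The C*-identity turns \<open>norm (s * s)\<close> into the square of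
  \<open>norm s\<close>, so a bound for left multiplication by \<open>s\<close>, tested on
  \<open>s\<close> itself, bounds \<open>norm s\<close>.\<close>

lemma norm_skew_le:
  fixes s :: "'a::cstar_algebra"
  assumes "star s = - s" "norm (s * s) \<le> K * norm s" "0 \<le> K"
  shows "norm s \<le> K"
proof (cases "s = 0")
  case False
  have "norm s * norm s \<le> K * norm s"
    using norm_star_mult_self[of s] assms by (simp add: power2_eq_square)
  then show ?thesis using False by simp
qed (use assms in simp)

text \<open>
  The hypotheses say that \<open>(1 - k) + c\<close> is unitary, with \<open>c\<close> as its skew-adjoint part.
\<close>

lemma norm_skew_part_unitary:
  fixes c k :: "'a::cstar_algebra"
  assumes "star c = - c" "star k = k" "c * k = k * c" "k * k - 2 *\<^sub>R k = c * c"
  shows "norm c \<le> 1"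
proof (rule norm_skew_le)
  \<comment> \<open>For \<open>d\<close> equal to \<open>c\<close> or to \<open>- c\<close> the
    element 1 + d - k is an isometry. The two differ by 2 c, and both are applied to
    \<open>c\<close> below.\<close>
  have iso: "norm (x + (d - k) * x) \<le> norm x"
    if "star d = - d" "d * k = k * d" "k * k - 2 *\<^sub>R k = d * d" for d x
  proof -
    have "(d - k) + star (d - k) + star (d - k) * (d - k) = 0"
      using that assms(2) by (simp add: star_diff algebra_simps scaleR_2)
    then have "(norm (x + (d - k) * x))\<^sup>2 \<le> (norm x)\<^sup>2"
      using norm_add_mult_sq[of x "d - k"] by simp
    then show ?thesis by (rule power2_le_imp_le) simp
  qed
  have "norm (2 *\<^sub>R (c * c)) = norm ((c + (c - k) * c) - (c + (- c - k) * c))"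
    by (simp add: algebra_simps scaleR_2)
  also have "\<dots> \<le> norm c + norm c"
    by (rule order_trans[OF norm_triangle_ineq4], intro add_mono iso)
      (use assms in \<open>auto simp: star_minus\<close>)
  finally show "norm (c * c) \<le> 1 * norm c"
    by simp
qed (use assms in auto)

text \<open>
  With \<open>h = - a\<^sup>2\<close> the element \<open>k = h (1/2 + n)\<close> is \<open>1 - sqrt (1 - h)\<close>; having the
  factor \<open>a\<close> split off keeps \<open>k\<close> inside every right ideal containing \<open>a\<close>.
  The equation \<open>2 k - k\<^sup>2 = h\<close> becomes the fixed point equation \<open>n = (1/2) (1/2 + n) h (1/2 + n)\<close>.
\<close>

lemma quasi_sqrt:
  fixes a :: "'a::cstar_algebra"
  assumes a: "star a = - a" "norm a < 1"
  obtains k n where "k = a * (- (1/2) *\<^sub>R a - a * n)" "star k = k" "a * k = k * a"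
    "k * k - 2 *\<^sub>R k = a * a"
proof -
  define h where "h = - (a * a)"
  define g where "g n = (1/2) *\<^sub>R ((1/4) *\<^sub>R h + (1/2) *\<^sub>R (n * h) + (1/2) *\<^sub>R (h * n) + n * h * n)" for n
  \<comment> \<open>The radius 1/2 keeps 1/2 + n of norm at most 1, so \<open>g\<close> maps
    \<open>S\<close> into itself and contracts by the factor \<open>norm h\<close>. The other two
    conditions are closed and pass to the fixed point.\<close>
  define S where "S = {n. norm n \<le> 1/2 \<and> star n = n \<and> a * n = n * a}"
  have h: "star h = h" "a * h = h * a" "norm h < 1"
  proof -
    have "norm h \<le> norm a * norm a"
      unfolding h_def by (simp add: norm_mult_ineq)
    also have "\<dots> < 1"
      using a(2) by (metis mult_strict_mono' norm_ge_zero mult_1)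
    finally show "norm h < 1" .
  qed (simp_all add: h_def star_minus star_mult a(1) mult.assoc)
  have "closed S"
    unfolding S_def by (intro closed_Collect_conj closed_Collect_le closed_Collect_eq continuous_intros
        linear_continuous_on[OF bounded_linear_star])
  then have "complete S"
    by (simp add: complete_eq_closed)
  moreover have "S \<noteq> {}"
    by (auto simp: S_def intro: exI[of _ 0])
  moreover have "g ` S \<subseteq> S"
  proof safe
    fix n assume "n \<in> S"
    then have n: "norm n \<le> 1/2" "star n = n" "a * n = n * a"
      by (auto simp: S_def)
    have 1: "norm (n * h) \<le> 1/2 * 1" "norm (h * n) \<le> 1 * (1/2)"
      using n(1) h(3) by (intro order_trans[OF norm_mult_ineq] mult_mono; simp)+
    then have 2: "norm (n * h * n) \<le> 1/2 * (1/2)"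
      using n(1) by (intro order_trans[OF norm_mult_ineq[of "n * h" n]] mult_mono) auto
    have "norm (g n) \<le> (1/2) * ((1/4) * norm h + (1/2) * norm (n * h) + (1/2) * norm (h * n) + norm (n * h * n))"
      unfolding g_def norm_scaleR
      by (rule mult_mono, simp, intro order_trans[OF norm_triangle_ineq] add_mono) auto
    also have "\<dots> \<le> 1/2"
      using h(3) 1 2 by simp
    finally have "norm (g n) \<le> 1/2" .
    moreover have "star (g n) = g n"
      using n h by (simp add: g_def star_scaleR star_add star_mult mult.assoc)
    moreover have "a * g n = g n * a"
    proof -
      have "a * (n * h) = n * h * a" "a * (h * n) = h * n * a"
        using n(3) h(2) by (metis mult.assoc)+
      moreover from this have "a * (n * h * n) = n * h * n * a"
        using n(3) by (metis mult.assoc)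
      ultimately show ?thesis
        using h(2) by (simp add: g_def distrib_left distrib_right)
    qed
    ultimately show "g n \<in> S"
      by (simp add: S_def)
  qed
  moreover have "dist (g m) (g n) \<le> norm h * dist m n" if "m \<in> S" "n \<in> S" for m n
  proof -
    have mn: "norm m \<le> 1/2" "norm n \<le> 1/2"
      using that by (auto simp: S_def)
    have "g m - g n = (1/2) *\<^sub>R ((1/2) *\<^sub>R ((m - n) * h) + (1/2) *\<^sub>R (h * (m - n)) + (m - n) * (h * m) + n * (h * (m - n)))"
      by (simp add: g_def algebra_simps)
    also have "norm \<dots> \<le> (1/2) * ((1/2) * norm ((m - n) * h) + (1/2) * norm (h * (m - n))
        + norm ((m - n) * (h * m)) + norm (n * (h * (m - n))))"
      unfolding norm_scaleR
      by (rule mult_mono, simp, intro order_trans[OF norm_triangle_ineq] add_mono) auto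
    also have "\<dots> \<le> (1/2) * ((1/2) * (norm (m - n) * norm h) + (1/2) * (norm h * norm (m - n))
        + norm (m - n) * (norm h * (1/2)) + (1/2) * (norm h * norm (m - n)))"
      using mn by (intro mult_left_mono add_mono order_trans[OF norm_mult_ineq] mult_mono mult_nonneg_nonneg) auto
    also have "\<dots> = norm h * norm (m - n)"
      by simp
    finally show ?thesis
      by (simp add: dist_norm)
  qed
  ultimately obtain n where n: "n \<in> S" "g n = n"
    using Banach_fix[of S "norm h" g] h(3) by auto
  define k where "k = (1/2) *\<^sub>R h + h * n"
  have an: "a * n = n * a" and hn: "h * n = n * h" and sn: "star n = n"
    using n(1) by (auto simp: S_def h_def mult.assoc) (metis mult.assoc)
  show ?thesis
  proof
    show "k = a * (- (1/2) *\<^sub>R a - a * n)"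
      by (simp add: k_def h_def algebra_simps)
    show "star k = k"
      using h(1) hn sn by (simp add: k_def star_add star_scaleR star_mult)
    show "a * k = k * a"
      using an h(2) by (simp add: k_def distrib_left distrib_right) (metis mult.assoc)
    \<comment> \<open>Both sides are h (1/2 + n) h (1/2 + n), since \<open>k\<close> is h (1/2 +
      n).\<close>
    have "2 *\<^sub>R (h * g n) = k * k"
      by (simp add: k_def g_def algebra_simps)
    then have "k * k = 2 *\<^sub>R (h * n)"
      by (simp add: n(2))
    then show "k * k - 2 *\<^sub>R k = a * a"
      by (simp add: k_def h_def algebra_simps)
  qed
qed

section \<open>Homomorphisms of C*-algebras\<close>

text \<open>
  The ideal need not be closed: this covers the span of the brackets, on which \<^const>\<open>right_map\<close> is
  defined at first, as well as homomorphisms on a whole C*-algebra.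
\<close>

locale star_hom_on_ideal =
  fixes I :: "'a::cstar_algebra set" and f :: "'a \<Rightarrow> 'b::cstar_algebra"
  assumes subspace: "csubspace I"
    and star_mem: "a \<in> I \<Longrightarrow> star a \<in> I"
    and mult_mem: "a \<in> I \<Longrightarrow> a * b \<in> I"
    and hom_add: "a \<in> I \<Longrightarrow> b \<in> I \<Longrightarrow> f (a + b) = f a + f b"
    and hom_scaleC: "a \<in> I \<Longrightarrow> f (c *\<^sub>C a) = c *\<^sub>C f a"
    and hom_mult: "a \<in> I \<Longrightarrow> b \<in> I \<Longrightarrow> f (a * b) = f a * f b"
    and hom_star: "a \<in> I \<Longrightarrow> f (star a) = star (f a)"
begin

lemma scaleC_mem: "a \<in> I \<Longrightarrow> c *\<^sub>C a \<in> I"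
  by (rule complex_vector.subspace_scale[OF subspace])

lemma scaleR_mem: "a \<in> I \<Longrightarrow> r *\<^sub>R a \<in> I"
  by (simp add: scaleR_scaleC scaleC_mem)

lemma add_mem: "a \<in> I \<Longrightarrow> b \<in> I \<Longrightarrow> a + b \<in> I"
  by (rule complex_vector.subspace_add[OF subspace])

lemma uminus_mem: "a \<in> I \<Longrightarrow> - a \<in> I"
  by (metis scaleC_mem scaleC_minus_one)

lemma diff_mem: "a \<in> I \<Longrightarrow> b \<in> I \<Longrightarrow> a - b \<in> I"
  using add_mem[of a "- b"] uminus_mem by simp

lemma hom_scaleR: "a \<in> I \<Longrightarrow> f (r *\<^sub>R a) = r *\<^sub>R f a"
  by (simp add: scaleR_scaleC hom_scaleC)

lemma hom_uminus: "a \<in> I \<Longrightarrow> f (- a) = - f a"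
  by (metis hom_scaleC scaleC_minus_one)

lemma hom_diff: "a \<in> I \<Longrightarrow> b \<in> I \<Longrightarrow> f (a - b) = f a - f b"
  using hom_add[of a "- b"] by (simp add: uminus_mem hom_uminus)

text \<open>The relations saying that (1 - k) + a is unitary involve only elements of
  \<open>I\<close>, so \<open>f\<close> carries them over to \<open>f a\<close> and
  \<open>f k\<close>.\<close>

lemma norm_hom_skew_le_1:
  assumes a: "a \<in> I" "star a = - a" "norm a < 1"
  shows "norm (f a) \<le> 1"
proof -
  obtain k n where k: "k = a * (- (1/2) *\<^sub>R a - a * n)" "star k = k" "a * k = k * a"
      "k * k - 2 *\<^sub>R k = a * a"
    using quasi_sqrt[OF a(2,3)] by blast
  have kI: "k \<in> I"
    unfolding k(1) by (rule mult_mem[OF a(1)])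
  have mem: "k * k \<in> I" "2 *\<^sub>R k \<in> I"
    using kI by (auto simp: scaleR_mem mult_mem)
  show ?thesis
  proof (rule norm_skew_part_unitary)
    show "star (f a) = - f a"
      using a by (metis hom_star hom_uminus)
    show "star (f k) = f k"
      using kI k(2) by (metis hom_star)
    show "f a * f k = f k * f a"
      using kI a(1) k(3) by (metis hom_mult)
    have "f (k * k - 2 *\<^sub>R k) = f k * f k - 2 *\<^sub>R f k"
      using mem kI by (simp add: hom_diff hom_mult hom_scaleR)
    then show "f k * f k - 2 *\<^sub>R f k = f a * f a"
      by (simp add: k(4) hom_mult a(1))
  qed
qed

lemma norm_hom_skew_le:
  assumes a: "a \<in> I" "star a = - a"
  shows "norm (f a) \<le> norm a"
proof (rule dense_ge)
  fix t assume t: "norm a < t"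
  then have "t > 0"
    by (rule le_less_trans[OF norm_ge_zero])
  then have "norm (f ((1 / t) *\<^sub>R a)) \<le> 1"
    using a t by (intro norm_hom_skew_le_1) (auto simp: scaleR_mem star_scaleR divide_simps)
  then show "norm (f a) \<le> t"
    using a(1) \<open>t > 0\<close> by (simp add: hom_scaleR divide_simps)
qed

lemma norm_hom_le:
  assumes a: "a \<in> I"
  shows "norm (f a) \<le> norm a"
proof -
  \<comment> \<open>The factor i makes the self-adjoint \<open>star a * a\<close> skew-adjoint
    without changing its norm.\<close>
  let ?h = "\<i> *\<^sub>C (star a * a)"
  have mem: "star a \<in> I" "star a * a \<in> I"
    using a by (auto intro: star_mem mult_mem)
  have "star ?h = - ?h"
    by (simp add: star_scaleC star_mult star_star)
  then have "norm (f ?h) \<le> norm ?h"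
    using mem by (intro norm_hom_skew_le scaleC_mem)
  then have "(norm (f a))\<^sup>2 \<le> (norm a)\<^sup>2"
    using mem a by (simp add: hom_scaleC hom_mult hom_star norm_scaleC norm_star_mult_self)
  then show ?thesis by (rule power2_le_imp_le) simp
qed

end

locale cstar_hom =
  fixes f :: "'a::cstar_algebra \<Rightarrow> 'b::cstar_algebra"
  assumes star_hom: "star_hom f"

sublocale cstar_hom \<subseteq> star_hom_on_ideal UNIV f
  using star_hom unfolding star_hom_def
  by unfold_locales
    (auto simp: complex_vector.subspace_UNIV Vector_Spaces.linear_iff)

context cstar_hom
begin

lemma bounded_linear_hom: "bounded_linear f"
  by (rule bounded_linear_intro[where K = 1]) (simp_all add: hom_add hom_scaleR norm_hom_le)

lemma hom_zero [simp]: "f 0 = 0"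
  by (rule linear_simps(3)[OF bounded_linear_hom])

end

subsection \<open>Closed range\<close>

text \<open>\<open>quasi_power c m\<close> is \<open>(1 + c)\<^sup>m - 1\<close>.\<close>

fun quasi_power :: "'a::cstar_algebra \<Rightarrow> nat \<Rightarrow> 'a" where
  "quasi_power c 0 = 0"
| "quasi_power c (Suc m) = quasi_power c m + c + c * quasi_power c m"

lemma quasi_power_commute: "c * quasi_power c m = quasi_power c m * c"
proof (induction m)
  case (Suc m)
  then have "c * (c * quasi_power c m) = (c * quasi_power c m) * c"
    by (metis mult.assoc)
  then show ?case
    by (simp only: quasi_power.simps distrib_left distrib_right Suc.IH)
qed simp

lemma star_quasi_power: "star (quasi_power c m) = quasi_power (star c) m"
  by (induction m) (auto simp: star_add star_mult quasi_power_commute)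

lemma (in cstar_hom) hom_quasi_power: "f (quasi_power c m) = quasi_power (f c) m"
  by (induction m) (auto simp: hom_add hom_mult)

text \<open>For skew-adjoint \<open>c\<close> the product (1 + c)^* (1 + c) = 1 - c^2 has no
  first-order term. Hence for c = a/m the bound does not grow with \<open>m\<close>, unlike (1 +
  norm c)^m.\<close>

lemma norm_add_quasi_power_mult:
  fixes c x :: "'a::cstar_algebra"
  assumes "star c = - c"
  shows "norm (x + quasi_power c m * x) \<le> sqrt (1 + (norm c)\<^sup>2) ^ m * norm x"
proof (induction m)
  case (Suc m)
  let ?y = "x + quasi_power c m * x" and ?K = "sqrt (1 + (norm c)\<^sup>2)"
  have "norm (star c * c) = (norm c)\<^sup>2"
    by (rule norm_star_mult_self)
  then have "(norm (?y + c * ?y))\<^sup>2 \<le> (?K * norm ?y)\<^sup>2"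
    using norm_add_mult_sq[of ?y c] assms by (simp add: power_mult_distrib)
  then have "norm (?y + c * ?y) \<le> ?K * norm ?y"
    by (rule power2_le_imp_le) simp
  also have "\<dots> \<le> ?K * (?K ^ m * norm x)"
    by (intro mult_left_mono Suc.IH) simp
  finally show ?case
    by (simp add: algebra_simps)
qed simp

text \<open>The difference collects the terms of degree at least two of (1 + c)^m; the bound is the
  same sum with \<open>norm c\<close> in place of \<open>c\<close>.\<close>

lemma norm_quasi_power_diff_le:
  "norm (quasi_power c m - real m *\<^sub>R c) \<le> (1 + norm c) ^ m - 1 - real m * norm c"
proof (induction m)
  case (Suc m)
  let ?d = "quasi_power c m - real m *\<^sub>R c"
  have "quasi_power c (Suc m) - real (Suc m) *\<^sub>R c = ?d + c * ?d + real m *\<^sub>R (c * c)"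
    by (simp add: algebra_simps)
  also have "norm \<dots> \<le> norm ?d + norm c * norm ?d + real m * (norm c * norm c)"
    by (intro order_trans[OF norm_triangle_ineq] add_mono norm_mult_ineq order_refl)
      (auto intro: mult_left_mono norm_mult_ineq)
  also have "\<dots> = (1 + norm c) * norm ?d + real m * (norm c * norm c)"
    by (simp add: algebra_simps)
  also have "\<dots> \<le> (1 + norm c) * ((1 + norm c) ^ m - 1 - real m * norm c) + real m * (norm c * norm c)"
    by (intro add_right_mono mult_left_mono Suc.IH) auto
  finally show ?case
    by (simp add: algebra_simps)
qed simp

text \<open>
  The skew-adjoint part of \<open>(1 + c)\<^sup>m\<close>, for \<open>c = a / m\<close> an approximation to \<open>sinh a\<close>: its norm
  stays bounded however large \<open>a\<close> is, and it is close to \<open>a\<close> for small \<open>a\<close>.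
\<close>

definition skew_power :: "'a::cstar_algebra \<Rightarrow> nat \<Rightarrow> 'a" where
  "skew_power c m = (1/2) *\<^sub>R (quasi_power c m - quasi_power (- c) m)"

lemma star_skew_power: "star c = - c \<Longrightarrow> star (skew_power c m) = - skew_power c m"
  by (simp add: skew_power_def star_scaleR star_diff star_quasi_power star_minus algebra_simps)

lemma (in cstar_hom) hom_skew_power: "f (skew_power c m) = skew_power (f c) m"
  by (simp add: skew_power_def hom_scaleR hom_diff hom_quasi_power hom_uminus)

lemma norm_skew_power_le:
  assumes c: "star c = - c"
  shows "norm (skew_power c m) \<le> sqrt (1 + (norm c)\<^sup>2) ^ m"
proof (rule norm_skew_le)
  let ?s = "skew_power c m" and ?K = "sqrt (1 + (norm c)\<^sup>2) ^ m"
  \<comment> \<open>Only the left factor is unfolded, as half of (1 + c)^m - (1 - c)^m, so that the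
    bound for left multiplication applies to each term.\<close>
  have "2 *\<^sub>R (?s * ?s) = (?s + quasi_power c m * ?s) - (?s + quasi_power (- c) m * ?s)"
    by (subst (1) skew_power_def) (simp add: algebra_simps)
  also have "norm \<dots> \<le> ?K * norm ?s + ?K * norm ?s"
    using norm_add_quasi_power_mult[of c ?s m] norm_add_quasi_power_mult[of "- c" ?s m] c
    by (intro order_trans[OF norm_triangle_ineq4] add_mono) (auto simp: star_minus)
  finally show "norm (?s * ?s) \<le> ?K * norm ?s"
    by (simp add: mult.commute)
qed (use c star_skew_power in auto)

lemma norm_skew_power_diff_le:
  "norm (skew_power c m - real m *\<^sub>R c) \<le> (1 + norm c) ^ m - 1 - real m * norm c"
proof -
  have "2 *\<^sub>R (skew_power c m - real m *\<^sub>R c)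
      = (quasi_power c m - real m *\<^sub>R c) - (quasi_power (- c) m - real m *\<^sub>R (- c))"
    by (simp add: skew_power_def algebra_simps flip: scaleR_2)
  then have "norm (2 *\<^sub>R (skew_power c m - real m *\<^sub>R c))
      \<le> norm (quasi_power c m - real m *\<^sub>R c) + norm (quasi_power (- c) m - real m *\<^sub>R (- c))"
    by (metis norm_triangle_ineq4)
  then show ?thesis
    using norm_quasi_power_diff_le[of c m] norm_quasi_power_diff_le[of "- c" m] by simp
qed

text \<open>Only the choice of \<open>m\<close> depends on \<open>norm a\<close>: once
  \<open>m\<close> is at least its square, the norm of \<open>skew_power\<close> is at most sqrt e <
  2. The error is computed in the image, where exp t - 1 - t is at most t^2 for t in [0, 1].\<close>

lemma (in cstar_hom) lift_small_skew:
  assumes a: "star a = - a" and fa: "norm (f a) \<le> 1"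
  obtains a' where "star a' = - a'" "norm a' \<le> 2" "norm (f a' - f a) \<le> (norm (f a))\<^sup>2"
proof -
  obtain m :: nat where m: "m > 0" "(norm a)\<^sup>2 \<le> real m"
  proof -
    obtain m :: nat where "(norm a)\<^sup>2 < real m"
      using reals_Archimedean2 by blast
    moreover from this have "0 < real m"
      by (rule le_less_trans[rotated]) simp
    ultimately show ?thesis
      using that[of m] by simp
  qed
  define c where "c = (1 / real m) *\<^sub>R a"
  have c: "star c = - c" "real m *\<^sub>R f c = f a" "real m * norm (f c) = norm (f a)"
    using a m(1) by (simp_all add: c_def star_scaleR hom_scaleR)
  have pow: "(1 + x) ^ m \<le> exp (real m * x)" if "0 \<le> x" for x
    using that exp_ge_add_one_self[of x] by (simp add: exp_of_nat_mult power_mono)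
  show ?thesis
  proof
    show "star (skew_power c m) = - skew_power c m"
      using c(1) by (rule star_skew_power)
    have "(sqrt (1 + (norm c)\<^sup>2) ^ m)\<^sup>2 = (1 + (norm c)\<^sup>2) ^ m"
      by (subst power_mult[symmetric], subst mult.commute, subst power_mult) simp
    also have "\<dots> \<le> exp (real m * (norm c)\<^sup>2)"
      by (rule pow) simp
    also have "real m * (norm c)\<^sup>2 = (norm a)\<^sup>2 / real m"
      using m(1) by (simp add: c_def power_divide power2_eq_square)
    also have "exp \<dots> \<le> exp 1"
      using m by (simp add: divide_simps)
    also have "\<dots> \<le> 2\<^sup>2"
      using exp_le by simp
    finally have "sqrt (1 + (norm c)\<^sup>2) ^ m \<le> 2"
      by (rule power2_le_imp_le) simp
    then show "norm (skew_power c m) \<le> 2"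
      using norm_skew_power_le[OF c(1), of m] by simp
    have "norm (f (skew_power c m) - f a) \<le> (1 + norm (f c)) ^ m - 1 - norm (f a)"
      using norm_skew_power_diff_le[of "f c" m] by (simp add: hom_skew_power c)
    also have "\<dots> \<le> exp (norm (f a)) - 1 - norm (f a)"
      using pow[of "norm (f c)"] by (simp add: c(3))
    also have "\<dots> \<le> (norm (f a))\<^sup>2"
      using exp_bound[of "norm (f a)"] fa by simp
    finally show "norm (f (skew_power c m) - f a) \<le> (norm (f a))\<^sup>2" .
  qed
qed

lemma (in cstar_hom) lift_skew:
  assumes a: "star a = - a"
  obtains a' where "norm a' \<le> 8 * norm (f a)" "norm (f a' - f a) \<le> norm (f a) / 4"
proof (cases "f a = 0")
  case True
  then show ?thesis using that[of 0] by simp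
next
  case False
  \<comment> \<open>The image is rescaled to norm 1/4: the quadratic error 1/16 is then a quarter of
    that norm, and the bound 2 is eight times it.\<close>
  define t where "t = 1 / (4 * norm (f a))"
  have t: "t > 0" "t * norm (f a) = 1/4"
    using False by (simp_all add: t_def)
  have fta: "norm (f (t *\<^sub>R a)) = 1/4"
    using t by (simp add: hom_scaleR)
  have "star (t *\<^sub>R a) = - (t *\<^sub>R a)"
    by (simp add: star_scaleR a)
  then obtain a' where a': "norm a' \<le> 2" "norm (f a' - f (t *\<^sub>R a)) \<le> (norm (f (t *\<^sub>R a)))\<^sup>2"
    by (rule lift_small_skew) (simp add: fta, blast)
  show ?thesis
  proof (rule that)
    show "norm ((1 / t) *\<^sub>R a') \<le> 8 * norm (f a)"
      using a'(1) t(1) by (simp add: t_def)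
    have "f ((1 / t) *\<^sub>R a') - f a = (1 / t) *\<^sub>R (f a' - f (t *\<^sub>R a))"
      using t(1) by (simp add: hom_scaleR algebra_simps)
    then have "norm (f ((1 / t) *\<^sub>R a') - f a) = (4 * norm (f a)) * norm (f a' - f (t *\<^sub>R a))"
      by (simp add: t_def)
    also have "\<dots> \<le> (4 * norm (f a)) * (1/4)\<^sup>2"
      using a'(2) unfolding fta by (intro mult_left_mono) auto
    finally show "norm (f ((1 / t) *\<^sub>R a') - f a) \<le> norm (f a) / 4"
      by (simp add: power2_eq_square)
  qed
qed

lemma (in cstar_hom) approximate_lift:
  obtains a' where "norm a' \<le> 16 * norm (f a)" "norm (f a' - f a) \<le> norm (f a) / 2"
proof -
  obtain b c where bc: "a = b + \<i> *\<^sub>C c" "star b = - b" "star c = - c"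
    and def: "b = (1/2) *\<^sub>R (a - star a)" "c = (- \<i> / 2) *\<^sub>C (a + star a)"
    by (rule decompose_skew)
  have le: "norm (f b) \<le> norm (f a)" "norm (f c) \<le> norm (f a)"
    using norm_triangle_ineq4[of "f a" "star (f a)"] norm_triangle_ineq[of "f a" "star (f a)"]
    by (simp_all add: def hom_scaleR hom_scaleC hom_add hom_diff hom_star norm_scaleC norm_divide
        del: complex_vector.scale_minus_left)
  obtain b' where b': "norm b' \<le> 8 * norm (f b)" "norm (f b' - f b) \<le> norm (f b) / 4"
    using lift_skew[OF bc(2)] by blast
  obtain c' where c': "norm c' \<le> 8 * norm (f c)" "norm (f c' - f c) \<le> norm (f c) / 4"
    using lift_skew[OF bc(3)] by blast
  show ?thesis
  proof (rule that)
    have "norm (b' + \<i> *\<^sub>C c') \<le> norm b' + norm (\<i> *\<^sub>C c')"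
      by (rule norm_triangle_ineq)
    also have "\<dots> \<le> 16 * norm (f a)"
      using b'(1) c'(1) le by (simp add: norm_scaleC)
    finally show "norm (b' + \<i> *\<^sub>C c') \<le> 16 * norm (f a)" .
    have "f (b' + \<i> *\<^sub>C c') - f a = (f b' - f b) + \<i> *\<^sub>C (f c' - f c)"
      by (simp add: bc(1) hom_add hom_scaleC complex_vector.scale_right_diff_distrib)
    also have "norm \<dots> \<le> norm (f b' - f b) + norm (\<i> *\<^sub>C (f c' - f c))"
      by (rule norm_triangle_ineq)
    also have "\<dots> \<le> norm (f a) / 2"
      using b'(2) c'(2) le by (simp add: norm_scaleC)
    finally show "norm (f (b' + \<i> *\<^sub>C c') - f a) \<le> norm (f a) / 2" .
  qed
qed

text \<open>Successive approximation: controlled lifts of the remainders form an absolutely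
  convergent series in the complete domain, and its sum is mapped to the given point of the
  closure.\<close>

lemma closed_range_if_approximate_lift:
  fixes f :: "'a::banach \<Rightarrow> 'b::real_normed_vector"
  assumes f: "bounded_linear f"
    and lift: "\<And>a. \<exists>a'. norm a' \<le> C * norm (f a) \<and> norm (f a' - f a) \<le> norm (f a) / 2"
  shows "closed (range f)"
proof -
  interpret bounded_linear f by fact
  \<comment> \<open>With \<open>f a\<close> within a quarter of \<open>norm b\<close> from
    \<open>b\<close>, its norm is at most 5/4 of \<open>norm b\<close>, and the total error factor
    is 1/4 + 5/8 = 7/8.\<close>
  have step: "\<exists>a. norm a \<le> 2 * \<bar>C\<bar> * norm b \<and> norm (b - f a) \<le> (7/8) * norm b"
    if b: "b \<in> closure (range f)" for b
  proof (cases "b = 0")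
    case True
    then show ?thesis by (intro exI[of _ 0]) (simp add: zero)
  next
    case False
    then have "norm b / 4 > 0" by simp
    then obtain a where a: "norm (f a - b) < norm b / 4"
      using b unfolding closure_approachable dist_norm by blast
    obtain a' where a': "norm a' \<le> C * norm (f a)" "norm (f a' - f a) \<le> norm (f a) / 2"
      using lift by blast
    have fa: "norm (f a) \<le> (5/4) * norm b"
      using a norm_triangle_sub[of "f a" b] by simp
    have "norm a' \<le> \<bar>C\<bar> * norm (f a)"
      by (rule order_trans[OF a'(1)]) (intro mult_right_mono, auto)
    also have "\<dots> \<le> \<bar>C\<bar> * (2 * norm b)"
      using fa norm_ge_zero[of b] by (intro mult_left_mono) linarith+
    finally have "norm a' \<le> 2 * \<bar>C\<bar> * norm b" by simp
    moreover have "norm (b - f a') \<le> norm (f a - b) + norm (f a' - f a)"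
      using norm_triangle_ineq[of "b - f a" "f a - f a'"] by (simp add: norm_minus_commute)
    ultimately show ?thesis
      using a a'(2) fa by (intro exI[of _ a']) auto
  qed
  then obtain l where l: "\<And>b. b \<in> closure (range f) \<Longrightarrow> norm (l b) \<le> 2 * \<bar>C\<bar> * norm b"
      "\<And>b. b \<in> closure (range f) \<Longrightarrow> norm (b - f (l b)) \<le> (7/8) * norm b"
    by metis
  \<comment> \<open>Remainders stay in the closure, so the step can be repeated on them.\<close>
  have closure_diff: "b - f a \<in> closure (range f)" if b: "b \<in> closure (range f)" for a b
    unfolding closure_approachable
  proof (intro allI impI)
    fix e :: real
    assume "e > 0"
    then obtain x where "dist (f x) b < e"
      using b unfolding closure_approachable by blast
    then have "dist (f (x - a)) (b - f a) < e"
      by (simp add: diff dist_norm)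
    then show "\<exists>y\<in>range f. dist y (b - f a) < e"
      by blast
  qed
  have "b \<in> range f" if b: "b \<in> closure (range f)" for b
  proof -
    define r where "r n = ((\<lambda>b. b - f (l b)) ^^ n) b" for n
    have r_Suc: "r (Suc n) = r n - f (l (r n))" for n
      by (simp add: r_def)
    have r: "r n \<in> closure (range f) \<and> norm (r n) \<le> (7/8) ^ n * norm b" for n
    proof (induction n)
      case 0
      then show ?case using b by (simp add: r_def)
    next
      case (Suc n)
      then show ?case
        using l(2)[of "r n"] closure_diff[of "r n" "l (r n)"] by (simp add: r_Suc)
    qed
    have "norm (l (r n)) \<le> (2 * \<bar>C\<bar> * norm b) * (7/8) ^ n" for n
    proof -
      have "norm (l (r n)) \<le> 2 * \<bar>C\<bar> * norm (r n)"
        using l(1) r by blast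
      also have "\<dots> \<le> 2 * \<bar>C\<bar> * ((7/8) ^ n * norm b)"
        using r by (intro mult_left_mono) auto
      finally show ?thesis by (simp add: mult_ac)
    qed
    then have "summable (\<lambda>n. l (r n))"
      by (intro summable_comparison_test'[OF summable_mult[OF summable_geometric]]) auto
    then have "(\<lambda>n. f (\<Sum>i<n. l (r i))) \<longlonglongrightarrow> f (\<Sum>n. l (r n))"
      by (intro tendsto summable_LIMSEQ)
    moreover have "f (\<Sum>i<n. l (r i)) = b - r n" for n
      by (induction n) (simp_all add: zero add r_Suc, simp add: r_def)
    moreover have "r \<longlonglongrightarrow> 0"
    proof (rule Lim_null_comparison)
      show "(\<lambda>n. (7/8) ^ n * norm b) \<longlonglongrightarrow> 0"
        by (intro tendsto_mult_left_zero LIMSEQ_power_zero) simp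
    qed (use r in auto)
    then have "(\<lambda>n. b - r n) \<longlonglongrightarrow> b - 0"
      by (intro tendsto_intros)
    ultimately have "f (\<Sum>n. l (r n)) = b"
      using LIMSEQ_unique by fastforce
    then show ?thesis by blast
  qed
  then show ?thesis
    using closure_subset by (metis closed_closure equalityI subsetI)
qed

lemma (in cstar_hom) closed_range_hom: "closed (range f)"
proof (rule closed_range_if_approximate_lift[OF bounded_linear_hom])
  show "\<exists>a'. norm a' \<le> 16 * norm (f a) \<and> norm (f a' - f a) \<le> norm (f a) / 2" for a
    using approximate_lift[of a] by blast
qed

section \<open>The right action\<close>

definition act :: "'a::cstar_tring \<Rightarrow> 'a right_algebra \<Rightarrow> 'a" where
  "act x a = blinfun_apply (op_of a) x"

lemma act_rbracket [simp]: "act x (rbracket y z) = tprod x y z"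
  by (simp add: act_def rbracket.rep_eq right_op.rep_eq)

lemma act_add_right: "act x (a + b) = act x a + act x b"
  and act_scaleC_right: "act x (c *\<^sub>C a) = c *\<^sub>C act x a"
  and act_mult: "act x (a * b) = act (act x a) b"
  and act_zero_right [simp]: "act x 0 = 0"
  by (simp_all add: act_def plus_right_algebra.rep_eq plus_blinfun.rep_eq
      scaleC_right_algebra.rep_eq scaleC_blinfun.rep_eq times_right_algebra.rep_eq
      zero_right_algebra.rep_eq)

lemma norm_act_le: "norm (act x a) \<le> norm x * norm a"
  using norm_blinfun[of "op_of a" x] by (simp add: act_def norm_right_algebra.rep_eq mult.commute)

lemma bounded_linear_act: "bounded_linear (act x)"
  by (rule bounded_linear_intro[where K = "norm x"])
    (simp_all add: act_add_right scaleR_scaleC act_scaleC_right norm_act_le mult.commute)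

lemma right_algebra_eqI: "(\<And>x. act x a = act x b) \<Longrightarrow> a = b"
  by (auto simp: act_def simp flip: op_of_inject intro: blinfun_eqI)

section \<open>The dense span of the brackets\<close>

definition bracket_span :: "'a::cstar_tring right_algebra set" where
  "bracket_span = cspan {rbracket y z | y z. True}"

lemma bracket_span_zero: "0 \<in> bracket_span"
  unfolding bracket_span_def by (rule complex_vector.span_zero)

lemma rbracket_in_span: "rbracket y z \<in> bracket_span"
  unfolding bracket_span_def by (rule complex_vector.span_base) blast

lemma bracket_span_step: "a \<in> bracket_span \<Longrightarrow> c *\<^sub>C rbracket y z + a \<in> bracket_span"
  using rbracket_in_span[of y z] unfolding bracket_span_def
  by (intro complex_vector.span_add complex_vector.span_scale)

lemma bracket_span_induct [consumes 1, case_names zero step]: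
  assumes "a \<in> bracket_span" "P 0" "\<And>c y z a. P a \<Longrightarrow> P (c *\<^sub>C rbracket y z + a)"
  shows "P a"
  using assms(1) unfolding bracket_span_def
  by (induction rule: complex_vector.span_induct_alt) (use assms(2,3) in auto)

lemma closure_bracket_span: "closure bracket_span = UNIV"
  unfolding bracket_span_def by (rule closure_cspan_rbracket)

lemma bracket_span_limit:
  obtains s where "\<And>n. s n \<in> bracket_span" "s \<longlonglongrightarrow> a"
  using closure_bracket_span closure_sequential[of a bracket_span] by blast

text \<open>By density, a closed condition on the completion need only be checked on linear
  combinations of brackets.\<close>

lemma right_algebra_induct [case_names closed zero step]:
  assumes "closed {a. P a}" "P 0" "\<And>c y z a. P a \<Longrightarrow> P (c *\<^sub>C rbracket y z + a)"
  shows "P a"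
proof -
  have "P a" if "a \<in> bracket_span" for a
    using that assms(2,3) by (rule bracket_span_induct)
  then have "closure bracket_span \<subseteq> {a. P a}"
    by (intro closure_minimal assms(1)) auto
  then show ?thesis
    using closure_bracket_span by blast
qed

section \<open>Brackets, the right action and the involution\<close>

lemma tprod_act_right: "tprod x y (act z a) = act (tprod x y z) a"
proof (induction a rule: right_algebra_induct)
  case closed
  have "bounded_linear (tprod x y)"
    by (rule bounded_linear_intro[where K = "norm x * norm y"])
      (use norm_tprod_le[of x y] in \<open>simp_all add: tprod_add_3 scaleR_scaleC tprod_scaleC_3 ac_simps\<close>)
  then show ?case
    by (intro closed_Collect_eq linear_continuous_on bounded_linear_act
        bounded_linear_compose[of "tprod x y" "act z"])
qed (simp_all add: act_add_right act_scaleC_right tprod_add_3 tprod_scaleC_3 tprod_assoc_3)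

lemma rbracket_mult: "rbracket y z * a = rbracket y (act z a)"
  by (rule right_algebra_eqI) (simp add: act_mult tprod_act_right)

text \<open>This is \<open>rbracket_mult\<close> under the involution; together they give a^* <y, z>
  a = <y a, z a>.\<close>

lemma star_mult_rbracket: "star a * rbracket y z = rbracket (act y a) z"
proof -
  have "star (rbracket z y * a) = star (rbracket z (act y a))"
    by (simp add: rbracket_mult)
  then show ?thesis
    by (simp add: star_mult star_rbracket)
qed

text \<open>The lower bound comes from evaluating the operator at \<open>x\<close> itself. Through
  this identity, contractivity on brackets becomes contractivity of the ternary
  homomorphism.\<close>

lemma norm_rbracket_self: "norm (rbracket x x) = (norm x)\<^sup>2"
proof (rule antisym)
  show "norm (rbracket x x) \<le> (norm x)\<^sup>2"
    unfolding norm_right_algebra.rep_eq rbracket.rep_eq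
    by (rule norm_blinfun_bound)
      (use norm_tprod_le[of _ x x] in \<open>auto simp: right_op.rep_eq power2_eq_square ac_simps\<close>)
  have "norm x * (norm x)\<^sup>2 \<le> norm x * norm (rbracket x x)"
    using norm_act_le[of x "rbracket x x"]
    by (simp add: norm_tprod_self power3_eq_cube power2_eq_square mult.assoc)
  then show "(norm x)\<^sup>2 \<le> norm (rbracket x x)"
    by (cases "x = 0") auto
qed

lemma rbracket_zero [simp]: "rbracket 0 z = 0" "rbracket y 0 = 0"
  by (rule right_algebra_eqI, simp)+

lemma bracket_span_mult: "a \<in> bracket_span \<Longrightarrow> a * b \<in> bracket_span"
  by (induction rule: bracket_span_induct)
    (auto simp: distrib_right mult_scaleC_left rbracket_mult bracket_span_zero intro: bracket_span_step)

lemma bracket_span_star: "a \<in> bracket_span \<Longrightarrow> star a \<in> bracket_span"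
  by (induction rule: bracket_span_induct)
    (auto simp: star_add star_scaleC star_rbracket bracket_span_zero intro: bracket_span_step)

section \<open>The induced homomorphism\<close>

locale cstar_tring_hom =
  fixes \<pi> :: "'a::cstar_tring \<Rightarrow> 'b::cstar_tring"
  assumes tring_hom: "tring_hom \<pi>"
begin

lemma hom_add: "\<pi> (x + y) = \<pi> x + \<pi> y"
  and hom_scaleC: "\<pi> (c *\<^sub>C x) = c *\<^sub>C \<pi> x"
  and hom_tprod: "\<pi> (tprod x y z) = tprod (\<pi> x) (\<pi> y) (\<pi> z)"
  using tring_hom by (auto simp: tring_hom_def Vector_Spaces.linear_iff)

lemma hom_zero [simp]: "\<pi> 0 = 0"
  using hom_add[of 0 0] by simp

text \<open>The graph of \<^const>\<open>right_map\<close> on the span of the brackets, not yet known to be single-valued.\<close>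

inductive induced :: "'a right_algebra \<Rightarrow> 'b right_algebra \<Rightarrow> bool" where
  zero: "induced 0 0"
| step: "induced a b \<Longrightarrow> induced (c *\<^sub>C rbracket y z + a) (c *\<^sub>C rbracket (\<pi> y) (\<pi> z) + b)"

lemma induced_rbracket: "induced (rbracket y z) (rbracket (\<pi> y) (\<pi> z))"
  using induced.step[OF induced.zero, of 1 y z] by simp

lemma induced_add: "induced a b \<Longrightarrow> induced a' b' \<Longrightarrow> induced (a + a') (b + b')"
  by (induction rule: induced.induct) (auto simp: add.assoc intro: induced.step)

lemma induced_scaleC: "induced a b \<Longrightarrow> induced (c *\<^sub>C a) (c *\<^sub>C b)"
  by (induction rule: induced.induct)
    (auto simp: scaleC_add_right scaleC_scaleC intro: induced.intros)

lemma induced_star: "induced a b \<Longrightarrow> induced (star a) (star b)"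
  by (induction rule: induced.induct)
    (auto simp: star_add star_scaleC star_rbracket intro: induced.intros)

text \<open>The intertwining relation holds for every pair in the graph, so it is available before
  the graph is known to be single-valued.\<close>

lemma hom_act: "induced a b \<Longrightarrow> \<pi> (act x a) = act (\<pi> x) b"
  by (induction rule: induced.induct)
    (auto simp: act_add_right act_scaleC_right hom_add hom_scaleC hom_tprod)

lemma induced_mult: "induced a b \<Longrightarrow> induced a' b' \<Longrightarrow> induced (a * a') (b * b')"
  by (induction rule: induced.induct)
    (auto simp: distrib_right mult_scaleC_left rbracket_mult hom_act[symmetric] intro: induced.intros)

lemma induced_total: "a \<in> bracket_span \<Longrightarrow> \<exists>b. induced a b"
  by (induction rule: bracket_span_induct) (auto intro: induced.intros)

text \<open>
  A priori \<open>d\<close> acts as \<open>0\<close> only on the range of \<open>\<pi>\<close>; this suffices because the brackets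
  occurring in \<open>star d\<close> take their values there.
\<close>

lemma induced_zero_left:
  assumes "induced 0 d"
  shows "d = 0"
proof -
  have act: "act (\<pi> x) d = 0" for x
    using hom_act[OF assms, of x] by simp
  have "b * d = 0" if "induced a b" for a b
    using that
    by (induction rule: induced.induct)
      (simp_all add: distrib_right mult_scaleC_left rbracket_mult act)
  then have "star d * d = 0"
    using induced_star[OF assms] by blast
  then show ?thesis
    by (rule star_mult_self_eq_0)
qed

lemma induced_unique:
  assumes "induced a b" "induced a b'"
  shows "b = b'"
proof -
  have "induced (a + (-1) *\<^sub>C a) (b + (-1) *\<^sub>C b')"
    by (intro induced_add induced_scaleC assms)
  then show ?thesis
    using induced_zero_left[of "b - b'"] by (simp add: scaleC_minus_one)
qed

definition induced_map :: "'a right_algebra \<Rightarrow> 'b right_algebra" where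
  "induced_map a = (THE b. induced a b)"

lemma induced_map_eq: "induced a b \<Longrightarrow> induced_map a = b"
  unfolding induced_map_def using induced_unique by blast

lemma induced_induced_map: "a \<in> bracket_span \<Longrightarrow> induced a (induced_map a)"
  using induced_total induced_map_eq by blast

sublocale induced: star_hom_on_ideal bracket_span induced_map
proof
  fix a b :: "'a right_algebra" and c :: complex
  show "csubspace (bracket_span :: 'a right_algebra set)"
    unfolding bracket_span_def by (rule complex_vector.subspace_span)
  assume a: "a \<in> bracket_span"
  then show "star a \<in> bracket_span" "a * b \<in> bracket_span"
    by (rule bracket_span_star bracket_span_mult)+
  note ia = induced_induced_map[OF a]
  show "induced_map (c *\<^sub>C a) = c *\<^sub>C induced_map a" "induced_map (star a) = star (induced_map a)"
    by (rule induced_map_eq induced_scaleC induced_star ia)+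
  assume "b \<in> bracket_span"
  note ib = induced_induced_map[OF this]
  show "induced_map (a + b) = induced_map a + induced_map b"
    "induced_map (a * b) = induced_map a * induced_map b"
    by (rule induced_map_eq induced_add induced_mult ia ib)+
qed

lemma norm_hom_le: "norm (\<pi> x) \<le> norm x"
proof -
  have "norm (induced_map (rbracket x x)) \<le> norm (rbracket x x)"
    by (rule induced.norm_hom_le[OF rbracket_in_span])
  then have "(norm (\<pi> x))\<^sup>2 \<le> (norm x)\<^sup>2"
    by (simp add: induced_map_eq[OF induced_rbracket] norm_rbracket_self)
  then show ?thesis
    by (rule power2_le_imp_le) simp
qed

lemma bounded_linear_hom: "bounded_linear \<pi>"
  by (rule bounded_linear_intro[where K = 1])
    (simp_all add: hom_add scaleR_scaleC hom_scaleC norm_hom_le)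

section \<open>Extension to the completion\<close>

lemma right_map_exists:
  "\<exists>f. star_hom f \<and> (\<forall>x y. f (rbracket x y) = rbracket (\<pi> x) (\<pi> y))"
proof -
  \<comment> \<open>Contractivity on the span gives uniform continuity, hence an extension to the
    closure, which is everything; the algebraic identities pass to limits.\<close>
  have "dist (induced_map a) (induced_map b) \<le> dist a b"
    if "a \<in> bracket_span" "b \<in> bracket_span" for a b
    using induced.norm_hom_le[OF induced.diff_mem[OF that]] that
    by (simp add: dist_norm induced.hom_diff)
  then have "uniformly_continuous_on bracket_span induced_map"
    unfolding uniformly_continuous_on_def by (meson order_le_less_trans)
  then obtain g where g: "uniformly_continuous_on (closure bracket_span) g"
      "\<And>a. a \<in> bracket_span \<Longrightarrow> induced_map a = g a"
    by (rule uniformly_continuous_on_extension_on_closure) blast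
  have lim: "(\<lambda>n. g (s n)) \<longlonglongrightarrow> g a" if "s \<longlonglongrightarrow> a" for s a
    using that uniformly_continuous_imp_continuous[OF g(1)]
    by (simp add: closure_bracket_span continuous_on_sequentially comp_def)
  have add: "g (a + b) = g a + g b" and mult: "g (a * b) = g a * g b" for a b
  proof -
    obtain s t where st: "\<And>n. s n \<in> bracket_span" "s \<longlonglongrightarrow> a" "\<And>n. t n \<in> bracket_span" "t \<longlonglongrightarrow> b"
      using bracket_span_limit by metis
    have "g (s n + t n) = g (s n) + g (t n)" "g (s n * t n) = g (s n) * g (t n)" for n
      using st by (simp_all flip: g(2) add: induced.hom_add induced.hom_mult induced.add_mem induced.mult_mem)
    then have "(\<lambda>n. g (s n) + g (t n)) \<longlonglongrightarrow> g (a + b)" "(\<lambda>n. g (s n) * g (t n)) \<longlonglongrightarrow> g (a * b)"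
      using lim[OF tendsto_add[OF st(2,4)]] lim[OF tendsto_mult[OF st(2,4)]] by simp_all
    then show "g (a + b) = g a + g b" "g (a * b) = g a * g b"
      using tendsto_add[OF lim[OF st(2)] lim[OF st(4)]] tendsto_mult[OF lim[OF st(2)] lim[OF st(4)]]
        LIMSEQ_unique by blast+
  qed
  have scale: "g (c *\<^sub>C a) = c *\<^sub>C g a" and star: "g (star a) = star (g a)" for c a
  proof -
    obtain s where s: "\<And>n. s n \<in> bracket_span" "s \<longlonglongrightarrow> a"
      using bracket_span_limit by metis
    have "g (c *\<^sub>C s n) = c *\<^sub>C g (s n)" "g (star (s n)) = star (g (s n))" for n
      using s by (simp_all flip: g(2) add: induced.hom_scaleC induced.hom_star induced.scaleC_mem induced.star_mem)
    then have "(\<lambda>n. c *\<^sub>C g (s n)) \<longlonglongrightarrow> g (c *\<^sub>C a)" "(\<lambda>n. star (g (s n))) \<longlonglongrightarrow> g (star a)"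
      using lim[OF bounded_linear.tendsto[OF bounded_linear_scaleC[of c] s(2)]] lim[OF tendsto_star[OF s(2)]]
      by simp_all
    then show "g (c *\<^sub>C a) = c *\<^sub>C g a" "g (star a) = star (g a)"
      using bounded_linear.tendsto[OF bounded_linear_scaleC[of c] lim[OF s(2)]] tendsto_star[OF lim[OF s(2)]]
        LIMSEQ_unique by blast+
  qed
  have "star_hom g"
    unfolding star_hom_def Vector_Spaces.linear_iff
    by (simp add: add mult scale star complex_vector.vector_space_axioms)
  moreover have "g (rbracket x y) = rbracket (\<pi> x) (\<pi> y)" for x y
    by (simp flip: g(2)[OF rbracket_in_span] add: induced_map_eq[OF induced_rbracket])
  ultimately show ?thesis
    by blast
qed

text \<open>*-homomorphisms of C*-algebras are automatically contractive, so agreement on the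
  brackets extends by density.\<close>

lemma right_map_unique:
  assumes f: "star_hom f" "\<And>x y. f (rbracket x y) = rbracket (\<pi> x) (\<pi> y)"
    and g: "star_hom g" "\<And>x y. g (rbracket x y) = rbracket (\<pi> x) (\<pi> y)"
  shows "f = g"
proof
  fix a
  interpret f: cstar_hom f using f(1) by unfold_locales
  interpret g: cstar_hom g using g(1) by unfold_locales
  show "f a = g a"
  proof (induction a rule: right_algebra_induct)
    case closed
    show ?case
      by (intro closed_Collect_eq linear_continuous_on f.bounded_linear_hom g.bounded_linear_hom)
  qed (simp_all add: f.hom_add f.hom_scaleC g.hom_add g.hom_scaleC f(2) g(2))
qed

lemma star_hom_right_map: "star_hom (right_map \<pi>)"
  and right_map_rbracket: "right_map \<pi> (rbracket x y) = rbracket (\<pi> x) (\<pi> y)"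
proof -
  have "\<exists>!f. star_hom f \<and> (\<forall>x y. f (rbracket x y) = rbracket (\<pi> x) (\<pi> y))"
    using right_map_exists right_map_unique by blast
  from theI'[OF this] show "star_hom (right_map \<pi>)"
    "right_map \<pi> (rbracket x y) = rbracket (\<pi> x) (\<pi> y)"
    unfolding right_map_def by blast+
qed

end

sublocale cstar_tring_hom \<subseteq> right: cstar_hom "right_map \<pi>"
  using star_hom_right_map by unfold_locales

lemma (in cstar_tring_hom) act_right_map: "\<pi> (act x a) = act (\<pi> x) (right_map \<pi> a)"
proof (induction a rule: right_algebra_induct)
  case closed
  show ?case
    by (intro closed_Collect_eq linear_continuous_on bounded_linear_compose[OF bounded_linear_hom]
        bounded_linear_compose[OF bounded_linear_act] right.bounded_linear_hom bounded_linear_act)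
qed (simp_all add: act_add_right act_scaleC_right hom_add hom_scaleC hom_tprod
    right.hom_add right.hom_scaleC right_map_rbracket)

section \<open>Exactness of the induced sequence\<close>

lemma (in cstar_tring_hom) inj_right_map:
  assumes "inj \<pi>"
  shows "inj (right_map \<pi>)"
proof (rule injI)
  fix a b
  assume eq: "right_map \<pi> a = right_map \<pi> b"
  have "act x a = act x b" for x
    by (rule injD[OF assms]) (simp add: act_right_map eq)
  then show "a = b"
    by (rule right_algebra_eqI)
qed

lemma (in cstar_hom) subspace_range: "csubspace (range f)"
  by (rule complex_vector.subspaceI) (auto simp flip: hom_add hom_scaleC hom_zero)

lemma (in cstar_tring_hom) surj_right_map:
  assumes "surj \<pi>"
  shows "surj (right_map \<pi>)"
proof -
  have bracket: "rbracket y z \<in> range (right_map \<pi>)" for y z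
    using assms right_map_rbracket by (metis rangeI surjD)
  have "b \<in> range (right_map \<pi>)" for b
  proof (induction b rule: right_algebra_induct)
    case zero
    show ?case by (rule complex_vector.subspace_0[OF right.subspace_range])
  next
    case (step c y z a)
    then show ?case
      by (intro complex_vector.subspace_add[OF right.subspace_range]
          complex_vector.subspace_scale[OF right.subspace_range] bracket)
  qed (simp add: right.closed_range_hom)
  then show ?thesis
    by blast
qed

section \<open>Closed subspaces containing cubes of skew-adjoint elements\<close>

lemma scaleR_3: "3 *\<^sub>R x = x + x + (x::'a::real_vector)"
  using scaleR_add_left[of 1 2 x] by (simp add: scaleR_2 add.assoc)

text \<open>
  For a skew-adjoint \<open>c\<close> of norm 1, the skew-adjoint part \<open>3 c + c\<^sup>3\<close> of \<open>(1 + c)\<^sup>3\<close> has norm at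
  most \<open>2 sqrt 2 < 2.85\<close>.
\<close>

lemma norm_skew_cubic_le:
  fixes c :: "'a::cstar_algebra"
  assumes c: "star c = - c" "norm c = 1"
  shows "norm (c + (1/3) *\<^sub>R (c * c * c)) \<le> 0.95"
proof -
  have "quasi_power c 3 - quasi_power (- c) 3 = 2 *\<^sub>R (3 *\<^sub>R c + c * c * c)"
    by (simp add: numeral_3_eq_3 algebra_simps scaleR_2 scaleR_3)
  then have "3 *\<^sub>R (c + (1/3) *\<^sub>R (c * c * c)) = skew_power c 3"
    by (simp add: skew_power_def scaleR_add_right)
  then have "3 * norm (c + (1/3) *\<^sub>R (c * c * c)) \<le> sqrt 2 ^ 3"
    using norm_skew_power_le[OF c(1), of 3] c(2)
    by (metis norm_scaleR abs_numeral one_add_one power_one)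
  also have "sqrt 2 ^ 3 \<le> 2.85"
    \<comment> \<open>Squaring reduces this to 8 <= 2.85^2 = 8.1225; the factor 0.95 is 2.85 /
      3.\<close>
    by (rule power2_le_imp_le) (simp_all add: power3_eq_cube power2_eq_square)
  finally show ?thesis
    by simp
qed

text \<open>Adding a multiple of the cube changes \<open>a\<close> only modulo \<open>J\<close>, yet
  shrinks its norm by 0.95. The iterates tend to 0 within the class of \<open>a\<close> modulo the
  closed \<open>J\<close>. Keeping them in \<open>I\<close> makes the hypothesis on cubes applicable
  again.\<close>

lemma skew_in_closed_subspace:
  fixes I J :: "'a::cstar_algebra set"
  assumes J: "csubspace J" "closed J"
    and I: "csubspace I" "\<And>a. a \<in> I \<Longrightarrow> star a = - a \<Longrightarrow> a * a * a \<in> I \<inter> J"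
    and a: "a \<in> I" "star a = - a"
  shows "a \<in> J"
proof -
  have scaleR: "r *\<^sub>R x \<in> K" if "csubspace K" "x \<in> K" for r x and K :: "'a set"
    using complex_vector.subspace_scale[OF that] by (simp add: scaleR_scaleC)
  have step: "\<exists>b. b \<in> I \<and> star b = - b \<and> b - a \<in> J \<and> norm b \<le> 0.95 * norm a"
    if a: "a \<in> I" "star a = - a" for a
  proof (cases "a = 0")
    case True
    then show ?thesis
      using complex_vector.subspace_0[OF J(1)] a by (intro exI[of _ 0]) simp
  next
    case False
    define c where "c = (1 / norm a) *\<^sub>R a"
    have c: "c \<in> I" "star c = - c" "norm c = 1" "a = norm a *\<^sub>R c"
      using False a scaleR[OF I(1)] by (auto simp: c_def star_scaleR)
    \<comment> \<open>This is a + a^3 / (3 norm(a)^2), written through the normalised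
      \<open>c\<close>.\<close>
    let ?b = "norm a *\<^sub>R (c + (1/3) *\<^sub>R (c * c * c))"
    have "?b \<in> I"
      using c(1,2) I by (intro scaleR[OF I(1)] complex_vector.subspace_add[OF I(1)]) auto
    moreover have "star ?b = - ?b"
      by (simp add: star_scaleR star_add star_mult c(2) mult.assoc algebra_simps)
    moreover have "?b - a = (norm a / 3) *\<^sub>R (c * c * c)"
      by (subst (2) c(4)) (simp add: algebra_simps)
    then have "?b - a \<in> J"
      using c(1,2) I(2) by (simp add: scaleR[OF J(1)])
    moreover have "norm ?b \<le> 0.95 * norm a"
      using norm_skew_cubic_le[OF c(2,3)] False by (simp add: mult.commute)
    ultimately show ?thesis
      by blast
  qed
  have "\<exists>b. b \<in> I \<and> star b = - b \<and> b - a \<in> J \<and> norm b \<le> 0.95 ^ n * norm a" for n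
  proof (induction n)
    case 0
    then show ?case
      using a complex_vector.subspace_0[OF J(1)] by (intro exI[of _ a]) simp
  next
    case (Suc n)
    then obtain b where b: "b \<in> I" "star b = - b" "b - a \<in> J" "norm b \<le> 0.95 ^ n * norm a"
      by blast
    obtain d where d: "d \<in> I" "star d = - d" "d - b \<in> J" "norm d \<le> 0.95 * norm b"
      using step[OF b(1,2)] by blast
    have "d - a \<in> J"
      using complex_vector.subspace_add[OF J(1) d(3) b(3)] by simp
    moreover have "norm d \<le> 0.95 ^ Suc n * norm a"
      using d(4) b(4) by simp
    ultimately show ?case
      using d by blast
  qed
  then obtain r where r: "\<And>n. r n - a \<in> J" "\<And>n. norm (r n) \<le> 0.95 ^ n * norm a"
    by metis
  have "r \<longlonglongrightarrow> 0"
  proof (rule Lim_null_comparison)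
    show "(\<lambda>n. 0.95 ^ n * norm a) \<longlonglongrightarrow> 0"
      by (intro tendsto_mult_left_zero LIMSEQ_power_zero) simp
  qed (use r in auto)
  then have "(\<lambda>n. r n - a) \<longlonglongrightarrow> 0 - a"
    by (intro tendsto_intros)
  then have "- a \<in> J"
    using closed_sequentially[OF J(2), of "\<lambda>n. r n - a"] r(1) by simp
  then show ?thesis
    using scaleR[OF J(1), of "- a" "-1"] by simp
qed

theorem corollary4p7:
  fixes \<phi> :: "'f1::cstar_tring \<Rightarrow> 'f2::cstar_tring"
    and \<psi> :: "'f2 \<Rightarrow> 'f3::cstar_tring"
  assumes "tring_exact \<phi> \<psi>"
  shows "cstar_exact (right_map \<phi>) (right_map \<psi>)"
proof -
  interpret \<phi>: cstar_tring_hom \<phi>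
    using assms by unfold_locales (simp add: tring_exact_def)
  interpret \<psi>: cstar_tring_hom \<psi>
    using assms by unfold_locales (simp add: tring_exact_def)
  have exact: "inj \<phi>" "surj \<psi>" and ker: "\<psi> x = 0 \<longleftrightarrow> x \<in> range \<phi>" for x
    using assms by (auto simp: tring_exact_def exact_maps_def)
  let ?I = "{a. right_map \<psi> a = 0}" and ?J = "range (right_map \<phi>)"
  have "right_map \<psi> (right_map \<phi> a) = 0" for a
  proof (induction a rule: right_algebra_induct)
    case closed
    show ?case
      by (intro closed_Collect_eq linear_continuous_on continuous_on_const \<phi>.right.bounded_linear_hom
          bounded_linear_compose[OF \<psi>.right.bounded_linear_hom])
  next
    case (step c y z a)
    moreover have "\<psi> (\<phi> y) = 0" for y
      using ker by blast
    ultimately show ?case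
      by (simp add: \<phi>.right.hom_add \<phi>.right.hom_scaleC \<phi>.right_map_rbracket
          \<psi>.right.hom_add \<psi>.right.hom_scaleC \<psi>.right_map_rbracket)
  qed simp
  then have sub: "?J \<subseteq> ?I"
    by blast
  have I_subspace: "csubspace ?I"
    by (rule complex_vector.subspaceI) (auto simp: \<psi>.right.hom_add \<psi>.right.hom_scaleC)
  have sandwich: "star a * b * a \<in> ?J" if a: "a \<in> ?I" for a b
  proof -
    have J_add: "x + y \<in> ?J" if "x \<in> ?J" "y \<in> ?J" for x y
      using that by (rule complex_vector.subspace_add[OF \<phi>.right.subspace_range])
    have "\<psi> (act y a) = 0" for y
      using a by (simp add: \<psi>.act_right_map)
    then have act: "act y a \<in> range \<phi>" for y
      using ker by blast
    have bracket: "star a * rbracket y z * a \<in> ?J" for y z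
    proof -
      obtain u v where "act y a = \<phi> u" "act z a = \<phi> v"
        using act by blast
      then have "star a * rbracket y z * a = right_map \<phi> (rbracket u v)"
        by (simp add: star_mult_rbracket rbracket_mult \<phi>.right_map_rbracket)
      then show ?thesis by simp
    qed
    show ?thesis
    proof (induction b rule: right_algebra_induct)
      case closed
      \<comment> \<open>Closedness of the range of \<open>right_map\<close> is what lets the bracket
        case extend to arbitrary \<open>b\<close>.\<close>
      have "{b. star a * b * a \<in> ?J} = (\<lambda>b. star a * b * a) -` ?J"
        by auto
      then show ?case
        by (auto intro!: closed_vimage \<phi>.right.closed_range_hom continuous_intros)
    next
      case zero
      show ?case
        by (simp add: complex_vector.subspace_0[OF \<phi>.right.subspace_range])
    next
      case (step c y z b)
      then show ?case
        by (simp add: distrib_left distrib_right mult_scaleC_left mult_scaleC_right J_add bracket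
            complex_vector.subspace_scale[OF \<phi>.right.subspace_range])
    qed
  qed
  have "a \<in> ?J" if a: "a \<in> ?I" for a
  proof -
    have skew: "c \<in> ?J" if "c \<in> ?I" "star c = - c" for c
    proof (rule skew_in_closed_subspace[OF \<phi>.right.subspace_range \<phi>.right.closed_range_hom I_subspace _ that])
      fix c assume c: "c \<in> ?I" "star c = - c"
      \<comment> \<open>The middle factor is taken to be \<open>c\<close> itself: for skew-adjoint
        \<open>c\<close>, \<open>star c * c * c\<close> is minus the cube.\<close>
      have "- (c * c * c) \<in> ?J"
        using sandwich[OF c(1), of c] c(2) by simp
      then have "c * c * c \<in> ?J"
        using complex_vector.subspace_neg[OF \<phi>.right.subspace_range, of "- (c * c * c)"]
        by (simp only: minus_minus)
      then show "c * c * c \<in> ?I \<inter> ?J"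
        using sub by blast
    qed
    obtain b c where bc: "a = b + \<i> *\<^sub>C c" "star b = - b" "star c = - c"
      and def: "b = (1/2) *\<^sub>R (a - star a)" "c = (- \<i> / 2) *\<^sub>C (a + star a)"
      by (rule decompose_skew)
    have "b \<in> ?I" "c \<in> ?I"
      using a by (simp_all add: def \<psi>.right.hom_scaleR \<psi>.right.hom_scaleC \<psi>.right.hom_add
          \<psi>.right.hom_diff \<psi>.right.hom_uminus \<psi>.right.hom_star)
    then show ?thesis
      unfolding bc(1) using skew bc(2,3)
      by (intro complex_vector.subspace_add[OF \<phi>.right.subspace_range]
          complex_vector.subspace_scale[OF \<phi>.right.subspace_range]) auto
  qed
  with sub have "?I = ?J"
    by blast
  then show ?thesis
    using \<phi>.star_hom_right_map \<psi>.star_hom_right_map \<phi>.inj_right_map[OF exact(1)]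
      \<psi>.surj_right_map[OF exact(2)]
    by (simp add: cstar_exact_def exact_maps_def)
qed

end
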